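(* Let $a,b$ be different positive integers with $b\geqslant 2$ and $N=a+b$. Let $V(a,b)$ (resp. $V(a,a)$) denote the underlying graded $\mathbb Q$-vector space of the minimal motive $M(a,b)$ (resp. $M(a,a)$), viewed as a graded representation of $U_{\mathrm{dR}}$. (1) If $a\geqslant2$ is even, then $V(a,a)=M_{2a}=\mathbb Q\,\zeta^{\mathfrak m}(a,a)$. (2) If $a\geqslant3$ is odd, then $V(a,a)=M_0\oplus M_a\oplus M_{2a}$, where $M_0$ is generated by $1$, $M_a$ by $\zeta^{\mathfrak m}(a)$ and $M_{2a}$ by $\zeta^{\mathfrak m}(a,a)$. (3) If $a$ and $b$ have the same parity, then $V(a,b)=\bigoplus_{i\in I(a,b)}M_i$, where $M_0$ is generated by $1$, $M_N$ is generated by $\zeta^{\mathfrak m}(a,b)$, and for all $i\in I(a,b)\setminus\{0,N\}$, $M_i$ is generated by $\zeta^{\mathfrak m}(i)$. (4) If $a$ and $b$ have different parities, then $V(a,b)=\bigoplus_{j\in J(a,b)}M_j$, where $M_0$ is generated by $1$, $M_N$ is generated by $\zeta^{\mathfrak m}(a,b)$, and for all $j\in J(a,b)\setminus\{0,N\}$, $M_j$ is generated by $\zeta^{\mathfrak m}(j)$. (Here $M_n$ denotes the part of degree $n$.)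
   Context: **Index sets.** For positive integers $a,b$ with $b\geqslant2$ and $N=a+b$, let $$I(a,b)=\begin{cases}\{0,a,2a\}& a=b\\ \{\text{odd } i\geqslant 3: b\leqslant i\leqslant N-2\}\cup\{0,N\}& b<a\\ \{\text{odd } i\geqslant 3: a+1\leqslant i\leqslant N-2\}\cup\{0,N\}& b>a.\end{cases}$$ Put $J(a,b)=\{N-i: i\in I(a,b)\}$. **Motivic multiple zeta values.** $\mathcal H=\bigoplus_{n\geqslant 0}\mathcal H_n$ is Brown's graded $\mathbb Q$-algebra of motivic multiple zeta values; $\mathcal H_n$ is spanned by motivic iterated integrals $I^{\mathfrak m}(\epsilon_0;\epsilon_1\dots\epsilon_n;\epsilon_{n+1})$, $\epsilon_i\in\{0,1\}$. $\zeta^{\mathfrak m}(n)=-I^{\mathfrak m}(0;1\,0^{n-1};1)$ and $\zeta^{\mathfrak m}(a,b)=I^{\mathfrak m}(0;1\,0^{a-1}\,1\,0^{b-1};1)$ ($0^k$ means $k$ zeros). Let $\mathcal A=\mathcal H/\zeta^{\mathfrak m}(2)\mathcal H$ and $\mathcal L=\mathcal A_{>0}/(\mathcal A_{>0})^2$, and write $I^{\mathcal L}$ for images in $\mathcal L$. For odd $r\geqslant 3$ and $n\geqslant r+2$, $D_r:\mathcal H_n\to\mathcal L_r\otimes\mathcal H_{n-r}$ is $$D_rI^{\mathfrak m}(\epsilon_0;\epsilon_1\dots \epsilon_n;\epsilon_{n+1})=\sum_{p=0}^{n-r}I^{\mathcal L}(\epsilon_p;\epsilon_{p+1}\dots \epsilon_{p+r};\epsilon_{p+r+1})\otimes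 I^{\mathfrak m}(\epsilon_0;\epsilon_1\dots \epsilon_{p}\,\epsilon_{p+r+1}\dots \epsilon_n;\epsilon_{n+1}).$$ **The $f$-alphabet.** $\mathcal U'=\mathbb Q\langle f_3,f_5,f_7,\dots\rangle$ is the graded Hopf algebra with basis the words in $f_{2k+1}$ ($k\geqslant1$, degree $2k+1$), shuffle product and deconcatenation coproduct; $\mathcal U=\mathcal U'\otimes\mathbb Q[f_2]$ with $f_2$ of degree 2. $\partial_r$ ($r\ge3$ odd) removes the first letter of a word if it is $f_r$, sends the word to $0$ otherwise, and kills $f_2$; $c_r:\mathcal U_r\to\mathbb Q$ gives the coefficient of $f_r$. Fix a normalized graded algebra isomorphism $\phi:\mathcal H\to\mathcal U$ compatible with coactions: $\phi(\zeta^{\mathfrak m}(2))=f_2$, $\phi(\zeta^{\mathfrak m}(2n+1))=f_{2n+1}$ ($n\ge1$), and $\phi^{-1}\partial_r\phi=((c_r\circ\phi)\otimes \mathrm{id})\circ D_r$. **Group action.** $\mathcal{MT}(\mathbb Z)$ is the Tannakian category of mixed Tate motives over $\mathbb Z$; its de Rham Tannakian group is $G_{\mathrm{dR}}=U_{\mathrm{dR}}\rtimes\mathbb G_m$ with $U_{\mathrm{dR}}=\operatorname{Spec}\mathcal U'$ prounipotent, so words in the $f_i$ are functions on $U_{\mathrm{dR}}$. $G_{\mathrm{dR}}$ acts on $\mathcal H\cong\mathcal U$: $t\in\mathbb G_m$ acts on degree $n$ by $t^n$, and $g\in U_{\mathrm{dR}}$ fixes $f_2$, acts by algebra automorphisms,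 and $g\cdot(f_{k_1}\dots f_{k_s})=\sum_{m=0}^{s}(f_{k_{m+1}}\dots f_{k_s})(g)\,f_{k_1}\dots f_{k_m}$. **Minimal motive.** $M(a,b)$ is the minimal object of $\mathcal{MT}(\mathbb Z)$ having $\zeta^{\mathfrak m}(a,b)$ as a motivic period; equivalently, it corresponds to the representation of $G_{\mathrm{dR}}$ on the $\mathbb Q$-span of the orbit $G_{\mathrm{dR}}\cdot\zeta^{\mathfrak m}(a,b)$. $M(a,a)$ is the case $b=a$.
   Formalization: In (3), the clause "M_0 is generated by 1" is not claimed for (a,b)=(1,3), where it is false: ζ^m(1,3) is a rational multiple of ζ^m(2)^2, so V(1,3) lies in degree 4 and M_0=0; everything else in (3) is still claimed for (1,3). *)

theory Defs
  imports "HOL-Analysis.Analysis" "HOL-Computational_Algebra.Polynomial"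
    "HOL-Library.Function_Algebras"
begin

section \<open>Vector spaces and commutative algebras over the rationals\<close>

class rat_vector = ab_group_add +
  fixes scaleQ :: "rat \<Rightarrow> 'a \<Rightarrow> 'a"  (infixr "*\<^sub>Q" 75)
  assumes scaleQ_add_right: "c *\<^sub>Q (x + y) = c *\<^sub>Q x + c *\<^sub>Q y"
    and scaleQ_add_left: "(c + d) *\<^sub>Q x = c *\<^sub>Q x + d *\<^sub>Q x"
    and scaleQ_scaleQ: "c *\<^sub>Q (d *\<^sub>Q x) = (c * d) *\<^sub>Q x"
    and scaleQ_one: "1 *\<^sub>Q x = x"

class rat_algebra_1 = rat_vector + comm_ring_1 +
  assumes mult_scaleQ_left: "(c *\<^sub>Q x) * y = c *\<^sub>Q (x * y)"

global_interpretation ratv: vector_space "scaleQ :: rat \<Rightarrow> 'a \<Rightarrow> 'a::rat_vector"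
  by unfold_locales (simp_all add: scaleQ_add_right scaleQ_add_left scaleQ_scaleQ scaleQ_one)

abbreviation spanQ :: "'a::rat_vector set \<Rightarrow> 'a set" where
  "spanQ \<equiv> module.span scaleQ"

definition rat_alg_hom :: "('a::rat_algebra_1 \<Rightarrow> 'b::rat_algebra_1) \<Rightarrow> bool" where
  "rat_alg_hom h \<longleftrightarrow>
     (\<forall>x y. h (x + y) = h x + h y) \<and> (\<forall>c x. h (c *\<^sub>Q x) = c *\<^sub>Q h x) \<and>
     (\<forall>x y. h (x * y) = h x * h y) \<and> h 1 = 1"

definition internal_direct_sum :: "'a::rat_vector set \<Rightarrow> 'i set \<Rightarrow> ('i \<Rightarrow> 'a set) \<Rightarrow> bool" where
  "internal_direct_sum V A M \<longleftrightarrow>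
     (\<forall>i\<in>A. M i \<subseteq> V) \<and>
     (\<forall>v\<in>V. \<exists>!m. (\<forall>i\<in>A. m i \<in> M i) \<and> (\<forall>i. i \<notin> A \<longrightarrow> m i = 0) \<and> v = (\<Sum>i\<in>A. m i))"

instantiation rat :: rat_algebra_1
begin
definition scaleQ_rat :: "rat \<Rightarrow> rat \<Rightarrow> rat" where "scaleQ_rat c x = c * x"
instance by standard (simp_all add: scaleQ_rat_def algebra_simps)
end

instantiation real :: rat_algebra_1
begin
definition scaleQ_real :: "rat \<Rightarrow> real \<Rightarrow> real" where "scaleQ_real c x = of_rat c * x"
instance by standard (simp_all add: scaleQ_real_def algebra_simps of_rat_add of_rat_mult)
end

instantiation "fun" :: (type, rat_vector) rat_vector
begin
definition scaleQ_fun :: "rat \<Rightarrow> ('a \<Rightarrow> 'b) \<Rightarrow> 'a \<Rightarrow> 'b" where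
  "scaleQ_fun c f = (\<lambda>x. c *\<^sub>Q f x)"
instance
  by standard (simp_all add: scaleQ_fun_def fun_eq_iff plus_fun_def scaleQ_add_right
      scaleQ_add_left scaleQ_scaleQ scaleQ_one)
end

instantiation poly :: (rat_algebra_1) rat_algebra_1
begin
definition scaleQ_poly :: "rat \<Rightarrow> 'a poly \<Rightarrow> 'a poly" where
  "scaleQ_poly c p = map_poly (scaleQ c) p"
instance
proof
  have cf: "coeff (c *\<^sub>Q p) n = c *\<^sub>Q coeff p n" for c and p :: "'a poly" and n
    by (simp add: scaleQ_poly_def coeff_map_poly)
  fix c d :: rat and p q :: "'a poly"
  show "c *\<^sub>Q (p + q) = c *\<^sub>Q p + c *\<^sub>Q q"
    by (simp add: poly_eq_iff cf scaleQ_add_right)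
  show "(c + d) *\<^sub>Q p = c *\<^sub>Q p + d *\<^sub>Q p"
    by (simp add: poly_eq_iff cf scaleQ_add_left)
  show "c *\<^sub>Q (d *\<^sub>Q p) = (c * d) *\<^sub>Q p"
    by (simp add: poly_eq_iff cf scaleQ_scaleQ)
  show "1 *\<^sub>Q p = p"
    by (simp add: poly_eq_iff cf scaleQ_one)
  show "(c *\<^sub>Q p) * q = c *\<^sub>Q (p * q)"
    by (simp add: poly_eq_iff cf coeff_mult mult_scaleQ_left ratv.scale_sum_right)
qed
end


section \<open>The shuffle algebra on an alphabet\<close>

text \<open>
  Finitely supported rational functions on words. In the product, taking the coefficients of
  the words starting with a given letter is a derivation, and so is given by the recursion
  below; \<open>word_Cons_mult\<close> recovers the usual recursive description of the shuffle
  of two words (counted with multiplicity, unlike the set \<open>shuffles\<close>).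
\<close>

typedef 'a shuf = "{f :: 'a list \<Rightarrow> rat. finite {w. f w \<noteq> 0}}"
  morphisms wcoeff Abs_shuf
  by (rule exI[of _ "\<lambda>_. 0"]) simp

setup_lifting type_definition_shuf

primrec shuffle_mult :: "('a list \<Rightarrow> rat) \<Rightarrow> ('a list \<Rightarrow> rat) \<Rightarrow> 'a list \<Rightarrow> rat" where
  "shuffle_mult f g [] = f [] * g []"
| "shuffle_mult f g (a # w) =
     shuffle_mult (\<lambda>u. f (a # u)) g w + shuffle_mult f (\<lambda>v. g (a # v)) w"

lemma shuffle_mult_support:
  "shuffle_mult f g w \<noteq> 0 \<Longrightarrow> \<exists>u v. f u \<noteq> 0 \<and> g v \<noteq> 0 \<and> w \<in> shuffles u v"
proof (induction w arbitrary: f g)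
  case Nil
  then show ?case by (auto intro!: exI[of _ "[]"])
next
  case (Cons a w)
  then consider "shuffle_mult (\<lambda>u. f (a # u)) g w \<noteq> 0" | "shuffle_mult f (\<lambda>v. g (a # v)) w \<noteq> 0"
    by fastforce
  then show ?case
  proof cases
    case 1
    from Cons.IH[OF this] show ?thesis by (metis Cons_in_shuffles_leftI)
  next
    case 2
    from Cons.IH[OF this] show ?thesis by (metis Cons_in_shuffles_rightI)
  qed
qed

lemma shuffle_mult_finite:
  assumes "finite {w. f w \<noteq> 0}" "finite {w. g w \<noteq> 0}"
  shows "finite {w. shuffle_mult f g w \<noteq> 0}"
proof (rule finite_subset)
  show "{w. shuffle_mult f g w \<noteq> 0} \<subseteq> (\<Union>u\<in>{w. f w \<noteq> 0}. \<Union>v\<in>{w. g w \<noteq> 0}. shuffles u v)"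
    using shuffle_mult_support by fastforce
  show "finite (\<Union>u\<in>{w. f w \<noteq> 0}. \<Union>v\<in>{w. g w \<noteq> 0}. shuffles u v)"
    using assms by auto
qed

lemma shuffle_mult_comm: "shuffle_mult f g w = shuffle_mult g f w"
  by (induction w arbitrary: f g) simp_all

lemma shuffle_mult_add: "shuffle_mult (\<lambda>w. f w + f' w) g w = shuffle_mult f g w + shuffle_mult f' g w"
  by (induction w arbitrary: f f' g) (simp_all add: algebra_simps)

lemma shuffle_mult_add2: "shuffle_mult f (\<lambda>w. g w + g' w) w = shuffle_mult f g w + shuffle_mult f g' w"
  by (induction w arbitrary: f g g') (simp_all add: algebra_simps)

lemma shuffle_mult_scale: "shuffle_mult (\<lambda>w. c * f w) g w = c * shuffle_mult f g w"
  by (induction w arbitrary: f g) (simp_all add: algebra_simps)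

lemma shuffle_mult_assoc:
  "shuffle_mult (shuffle_mult f g) h w = shuffle_mult f (shuffle_mult g h) w"
  by (induction w arbitrary: f g h) (simp_all add: algebra_simps shuffle_mult_add shuffle_mult_add2)

lemma shuffle_mult_zero: "shuffle_mult (\<lambda>w. 0) g w = 0"
  by (induction w arbitrary: g) simp_all

lemma shuffle_mult_one: "shuffle_mult (\<lambda>w. if w = [] then 1 else 0) g w = g w"
  by (induction w arbitrary: g) (simp_all add: shuffle_mult_zero)

instantiation shuf :: (type) rat_algebra_1
begin

lift_definition zero_shuf :: "'a shuf" is "\<lambda>_. 0" by simp
lift_definition one_shuf :: "'a shuf" is "\<lambda>w. if w = [] then 1 else 0" by simp
lift_definition plus_shuf :: "'a shuf \<Rightarrow> 'a shuf \<Rightarrow> 'a shuf" is "\<lambda>f g w. f w + g w"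
proof -
  fix f g :: "'a list \<Rightarrow> rat" assume "finite {w. f w \<noteq> 0}" "finite {w. g w \<noteq> 0}"
  then have "finite ({w. f w \<noteq> 0} \<union> {w. g w \<noteq> 0})" by simp
  then show "finite {w. f w + g w \<noteq> 0}" by (rule rev_finite_subset) auto
qed
lift_definition uminus_shuf :: "'a shuf \<Rightarrow> 'a shuf" is "\<lambda>f w. - f w" by simp
lift_definition minus_shuf :: "'a shuf \<Rightarrow> 'a shuf \<Rightarrow> 'a shuf" is "\<lambda>f g w. f w - g w"
proof -
  fix f g :: "'a list \<Rightarrow> rat" assume "finite {w. f w \<noteq> 0}" "finite {w. g w \<noteq> 0}"
  then have "finite ({w. f w \<noteq> 0} \<union> {w. g w \<noteq> 0})" by simp
  then show "finite {w. f w - g w \<noteq> 0}" by (rule rev_finite_subset) auto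
qed
lift_definition scaleQ_shuf :: "rat \<Rightarrow> 'a shuf \<Rightarrow> 'a shuf" is "\<lambda>c f w. c * f w"
  by (rule finite_subset) auto
lift_definition times_shuf :: "'a shuf \<Rightarrow> 'a shuf \<Rightarrow> 'a shuf" is shuffle_mult
  by (rule shuffle_mult_finite)

instance
proof
  fix x y z :: "'a shuf" and c d :: rat
  show "x * y * z = x * (y * z)" by transfer (simp add: fun_eq_iff shuffle_mult_assoc)
  show "x * y = y * x" by transfer (simp add: fun_eq_iff shuffle_mult_comm)
  show "1 * x = x" by transfer (simp add: fun_eq_iff shuffle_mult_one)
  show "(x + y) * z = x * z + y * z" by transfer (simp add: fun_eq_iff shuffle_mult_add)
  show "(c *\<^sub>Q x) * y = c *\<^sub>Q (x * y)" by transfer (simp add: fun_eq_iff shuffle_mult_scale)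
  show "(0::'a shuf) \<noteq> 1" by transfer (auto simp: fun_eq_iff)
qed (transfer, simp add: fun_eq_iff algebra_simps; fail)+

end

lift_definition word :: "'a list \<Rightarrow> 'a shuf" is "\<lambda>w v. if v = w then 1 else 0" by simp

lift_definition prefix_letter :: "'a \<Rightarrow> 'a shuf \<Rightarrow> 'a shuf" is
  "\<lambda>a f w. case w of [] \<Rightarrow> 0 | b # u \<Rightarrow> if b = a then f u else 0"
proof -
  fix a :: 'a and f :: "'a list \<Rightarrow> rat" assume "finite {w. f w \<noteq> 0}"
  then have "finite ((#) a ` {w. f w \<noteq> 0})" by simp
  moreover have "{w. (case w of [] \<Rightarrow> 0 | b # u \<Rightarrow> if b = a then f u else 0) \<noteq> 0}
      \<subseteq> (#) a ` {w. f w \<noteq> 0}"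
  proof
    fix w assume "w \<in> {w. (case w of [] \<Rightarrow> 0 | b # u \<Rightarrow> if b = a then f u else 0) \<noteq> 0}"
    then show "w \<in> (#) a ` {w. f w \<noteq> 0}" by (cases w) (auto split: if_splits)
  qed
  ultimately show "finite {w. (case w of [] \<Rightarrow> 0 | b # u \<Rightarrow> if b = a then f u else 0) \<noteq> 0}"
    by (rule rev_finite_subset)
qed

lemma word_Nil: "word [] = 1"
  by transfer simp

lemma word_Cons_mult:
  "word (a # u) * word (b # v) =
     prefix_letter a (word u * word (b # v)) + prefix_letter b (word (a # u) * word v)"
proof (transfer, rule ext)
  fix a b :: 'a and u v w :: "'a list"
  show "shuffle_mult (\<lambda>x. if x = a # u then 1 else 0) (\<lambda>x. if x = b # v then 1 else 0) w =
    (case w of [] \<Rightarrow> 0 | c # w' \<Rightarrow> if c = a then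
       shuffle_mult (\<lambda>x. if x = u then 1 else 0) (\<lambda>x. if x = b # v then 1 else 0) w' else 0) +
    (case w of [] \<Rightarrow> 0 | c # w' \<Rightarrow> if c = b then
       shuffle_mult (\<lambda>x. if x = a # u then 1 else 0) (\<lambda>x. if x = v then 1 else 0) w' else 0)"
  proof (cases w)
    case (Cons c w')
    have e: "(\<lambda>x. if c # x = d # y then (1::rat) else 0) =
        (if c = d then (\<lambda>x. if x = y then 1 else 0) else (\<lambda>_. 0))" for d y
      by (auto simp: fun_eq_iff)
    have z: "shuffle_mult f (\<lambda>_. 0) w' = 0" for f
      by (subst shuffle_mult_comm) (rule shuffle_mult_zero)
    show ?thesis by (simp only: Cons shuffle_mult.simps e) (simp add: shuffle_mult_zero z)
  qed simp
qed

definition supp :: "'a shuf \<Rightarrow> 'a list set" where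
  "supp x = {w. wcoeff x w \<noteq> 0}"

definition lin :: "('a list \<Rightarrow> 'b::rat_vector) \<Rightarrow> 'a shuf \<Rightarrow> 'b" where
  "lin F x = (\<Sum>w\<in>supp x. wcoeff x w *\<^sub>Q F w)"

lemma finite_supp: "finite (supp x)"
  unfolding supp_def by transfer

lemma lin_superset:
  assumes "finite S" "supp x \<subseteq> S"
  shows "lin F x = (\<Sum>w\<in>S. wcoeff x w *\<^sub>Q F w)"
  unfolding lin_def using assms by (intro sum.mono_neutral_left) (auto simp: supp_def)

lemma lin_add: "lin F (x + y) = lin F x + lin F y"
proof -
  let ?S = "supp x \<union> supp y"
  have f: "finite ?S" by (simp add: finite_supp)
  have "supp (x + y) \<subseteq> ?S" by (auto simp: supp_def plus_shuf.rep_eq)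
  then show ?thesis
    by (simp add: lin_superset[OF f] plus_shuf.rep_eq scaleQ_add_left sum.distrib)
qed

lemma lin_scaleQ: "lin F (c *\<^sub>Q x) = c *\<^sub>Q lin F x"
proof -
  have "supp (c *\<^sub>Q x) \<subseteq> supp x" by (auto simp: supp_def scaleQ_shuf.rep_eq)
  then show ?thesis
    unfolding lin_superset[OF finite_supp \<open>supp (c *\<^sub>Q x) \<subseteq> supp x\<close>]
    by (simp add: scaleQ_shuf.rep_eq lin_def ratv.scale_sum_right)
qed

lemma lin_word: "lin F (word w) = F w"
proof -
  have "supp (word w) = {w}" by (auto simp: supp_def word.rep_eq)
  then show ?thesis by (simp add: lin_def word.rep_eq scaleQ_one)
qed

lemma lin_one: "lin F 1 = F []"
  by (simp add: word_Nil[symmetric] lin_word)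

lemma lin_zero: "lin F 0 = 0"
  by (simp add: lin_def supp_def zero_shuf.rep_eq)

definition len_part :: "nat \<Rightarrow> 'a shuf \<Rightarrow> 'a shuf" where
  "len_part n = lin (\<lambda>w. if length w = n then word w else 0)"


section \<open>Formal iterated integrals and their regularized values\<close>

text \<open>
  \<open>False\<close> and \<open>True\<close> stand for the letters 0 and 1, so \<open>bool shuf\<close> is the
  affine ring of the de Rham torsor of paths from 0 to 1 in the projective line minus three points.
  \<open>II x w y\<close> is the formal symbol \<open>I(x; w; y)\<close>, the endpoints other than
  \<open>(0,1)\<close> being reduced to that case by path reversal and triviality of loops.
\<close>

definition II :: "bool \<Rightarrow> bool list \<Rightarrow> bool \<Rightarrow> bool shuf" where
  "II x w y =
     (if w = [] then 1 else if x = y then 0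
      else if y then word w else (-1) ^ length w *\<^sub>Q word (rev w))"

text \<open>Multiple zeta values, in the convention \<open>0 < k\<^sub>1 < \<dots> < k\<^sub>d\<close> (the last exponent must be at least 2).\<close>

definition mzv :: "nat list \<Rightarrow> real" where
  "mzv ns = (\<Sum>\<^sub>\<infinity>ks\<in>{ks. length ks = length ns \<and> sorted_wrt (<) (0 # ks)}.
      \<Prod>i<length ns. 1 / real (ks ! i) ^ (ns ! i))"

text \<open>On \<open>1 0\<^sup>n\<^sup>1\<^sup>-\<^sup>1 \<dots> 1 0\<^sup>n\<^sup>d\<^sup>-\<^sup>1\<close> this is the list of the \<open>n\<^sub>i\<close>; it is used only for words starting with 1.\<close>

primrec exponents :: "bool list \<Rightarrow> nat list" where
  "exponents [] = []"
| "exponents (x # w) = (if x then Suc (length (takeWhile Not w)) # exponents w else exponents w)"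

definition per_adm :: "bool list \<Rightarrow> real" where
  "per_adm w = (-1) ^ length (exponents w) * mzv (exponents w)"

text \<open>
  Shuffle regularization. Modulo the ideal generated by the letter 0,
  \<open>0\<^sup>m 1 v\<close> equals \<open>(-1)\<^sup>m 1 (0\<^sup>m sh v)\<close>, and modulo the ideal generated by the letter 1,
  \<open>v 0 1\<^sup>n\<close> equals \<open>(-1)\<^sup>n (v sh 1\<^sup>n) 0\<close>. Applying the second rule and then the first is the
  algebra homomorphism onto the span of the words that are empty or of the form \<open>1 \<dots> 0\<close>
  which kills both letters.
\<close>

definition reg_left :: "bool list \<Rightarrow> bool shuf" where
  "reg_left w = (let m = length (takeWhile Not w) in
     case dropWhile Not w of
       [] \<Rightarrow> if m = 0 then 1 else 0
     | _ # v \<Rightarrow> (-1) ^ m *\<^sub>Q lin (\<lambda>u. word (True # u)) (word (replicate m False) * word v))"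

definition reg_right :: "bool list \<Rightarrow> bool shuf" where
  "reg_right w = (let n = length (takeWhile (\<lambda>x. x) (rev w)) in
     case dropWhile (\<lambda>x. x) (rev w) of
       [] \<Rightarrow> if n = 0 then 1 else 0
     | _ # v \<Rightarrow> (-1) ^ n *\<^sub>Q lin (\<lambda>u. word (u @ [False])) (word (rev v) * word (replicate n True)))"

text \<open>The period map: regularized iterated integration along the straight path from 0 to 1.\<close>

definition per :: "bool shuf \<Rightarrow> real" where
  "per x = lin per_adm (lin reg_left (lin reg_right x))"


section \<open>Motivic multiple zeta values\<close>

text \<open>
  Elements of the tensor square of \<open>bool shuf\<close> are written as functions on pairs of words.
  \<open>coact\<close> is the Goncharov-Brown coaction: on \<open>I(0; a\<^sub>1 \<dots> a\<^sub>n; 1)\<close> it is the sum over all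
  subsequences \<open>0 = i\<^sub>0 < i\<^sub>1 < \<dots> < i\<^sub>k < i\<^sub>k\<^sub>+\<^sub>1 = n + 1\<close> of the product of the
  \<open>I(a\<^bsub>i\<^sub>p\<^esub>; \<dots>; a\<^bsub>i\<^sub>p\<^sub>+\<^sub>1\<^esub>)\<close> tensor \<open>I(0; a\<^bsub>i\<^sub>1\<^esub> \<dots> a\<^bsub>i\<^sub>k\<^esub>; 1)\<close>.
\<close>

definition tensor :: "bool shuf \<Rightarrow> bool shuf \<Rightarrow> bool list \<times> bool list \<Rightarrow> rat" where
  "tensor x y = (\<lambda>(u, v). wcoeff x u * wcoeff y v)"

definition coact_word :: "bool list \<Rightarrow> bool list \<times> bool list \<Rightarrow> rat" where
  "coact_word w = (let n = length w; s = False # w @ [True] in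
     \<Sum>S\<in>Pow {1..n}. let L = sorted_list_of_set S in
       tensor
         (\<Prod>(i, j)\<leftarrow>zip (0 # L) (L @ [n + 1]).
            II (s ! i) (take (j - i - 1) (drop (i + 1) s)) (s ! j))
         (II False (map ((!) s) L) True))"

definition coact :: "bool shuf \<Rightarrow> bool list \<times> bool list \<Rightarrow> rat" where
  "coact = lin coact_word"

definition zeta2 :: "bool shuf" where
  "zeta2 = - II False [True, False] True"

text \<open>
  Graded ideals in the kernel of the period map which are stable under the coaction, the left
  tensor factor being taken modulo the ideal and \<open>\<zeta>(2)\<close>. Brown's ring of motivic multiple
  zeta values is the quotient by the largest such ideal.
\<close>

definition motivic_relations :: "bool shuf set \<Rightarrow> bool" where
  "motivic_relations R \<longleftrightarrow>
     0 \<in> R \<and> (\<forall>x\<in>R. \<forall>y\<in>R. x + y \<in> R) \<and> (\<forall>x\<in>R. \<forall>y. y * x \<in> R) \<and>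
     (\<forall>x\<in>R. \<forall>n. len_part n x \<in> R) \<and>
     (\<forall>x\<in>R. per x = 0) \<and>
     (\<forall>x\<in>R. coact x \<in> spanQ {tensor u v | u v. (\<exists>r\<in>R. \<exists>y. u = r + zeta2 * y) \<or> v \<in> R})"

definition J_MT :: "bool shuf set" where
  "J_MT = spanQ (\<Union>{R. motivic_relations R})"

lemma motivic_relationsD:
  assumes "motivic_relations R"
  shows "\<forall>x\<in>R. \<forall>y. y * x \<in> R" "\<forall>x\<in>R. \<forall>n. len_part n x \<in> R" "\<forall>x\<in>R. per x = 0"
    "\<forall>x\<in>R. coact x \<in> spanQ {tensor u v | u v. (\<exists>r\<in>R. \<exists>y. u = r + zeta2 * y) \<or> v \<in> R}"
  using assms unfolding motivic_relations_def by - (elim conjE, assumption)+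

lemma per_add: "per (x + y) = per x + per y"
  by (simp add: per_def lin_add)

lemma per_scaleQ: "per (c *\<^sub>Q x) = c *\<^sub>Q per x"
  by (simp add: per_def lin_scaleQ)

lemma per_zero: "per 0 = 0"
  by (simp add: per_def lin_zero)

lemma J_MT_per: "x \<in> J_MT \<Longrightarrow> per x = 0"
  unfolding J_MT_def
  by (induction x rule: ratv.span_induct_alt)
    (auto simp: per_add per_scaleQ per_zero motivic_relationsD(3))

lemma J_MT_mult: "x \<in> J_MT \<Longrightarrow> y * x \<in> J_MT"
  unfolding J_MT_def
proof (induction x rule: ratv.span_induct_alt)
  case base
  show ?case by (simp add: ratv.span_zero)
next
  case (step c x z)
  have "y * (c *\<^sub>Q x + z) = c *\<^sub>Q (y * x) + y * z"
    by (simp add: distrib_left mult_scaleQ_left mult.commute[of y])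
  moreover have "y * x \<in> \<Union> {R. motivic_relations R}"
    using step(1) motivic_relationsD(1) by blast
  ultimately show ?case
    using step(2) by (metis ratv.span_add ratv.span_base ratv.span_scale)
qed

lemma J_MT_motivic_relations: "motivic_relations J_MT"
  unfolding motivic_relations_def
proof (intro conjI ballI allI)
  show "0 \<in> J_MT" by (simp add: J_MT_def ratv.span_zero)
next
  fix x y assume "x \<in> J_MT" "y \<in> J_MT"
  then show "x + y \<in> J_MT" by (simp add: J_MT_def ratv.span_add)
next
  fix x y assume "x \<in> J_MT"
  then show "y * x \<in> J_MT" by (rule J_MT_mult)
next
  fix x n assume "x \<in> J_MT"
  then show "len_part n x \<in> J_MT"
    unfolding J_MT_def
  proof (induction x rule: ratv.span_induct_alt)
    case base
    show ?case by (simp add: len_part_def lin_zero ratv.span_zero)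
  next
    case (step c x z)
    have "len_part n (c *\<^sub>Q x + z) = c *\<^sub>Q len_part n x + len_part n z"
      by (simp add: len_part_def lin_add lin_scaleQ)
    moreover have "len_part n x \<in> \<Union> {R. motivic_relations R}"
      using step(1) motivic_relationsD(2) by blast
    ultimately show ?case
      using step(2) by (metis ratv.span_add ratv.span_base ratv.span_scale)
  qed
next
  fix x assume "x \<in> J_MT"
  then show "per x = 0" by (rule J_MT_per)
next
  fix x assume "x \<in> J_MT"
  let ?T = "\<lambda>R. {tensor u v | u v. (\<exists>r\<in>R. \<exists>y. u = r + zeta2 * y) \<or> v \<in> R}"
  show "coact x \<in> spanQ (?T J_MT)"
    using \<open>x \<in> J_MT\<close> unfolding J_MT_def
  proof (induction x rule: ratv.span_induct_alt)
    case base
    show ?case unfolding coact_def lin_zero by (rule ratv.span_zero)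
  next
    case (step c x z)
    then obtain R where R: "motivic_relations R" "x \<in> R" by auto
    have sub: "R \<subseteq> spanQ (\<Union> {R. motivic_relations R})"
      using R(1) by (auto intro: ratv.span_base)
    have "coact x \<in> spanQ (?T R)" using R(2) by (rule bspec[OF motivic_relationsD(4)[OF R(1)]])
    moreover have "spanQ (?T R) \<subseteq> spanQ (?T (spanQ (\<Union> {R. motivic_relations R})))"
      by (rule ratv.span_mono) (use sub in blast)
    ultimately have "coact x \<in> spanQ (?T (spanQ (\<Union> {R. motivic_relations R})))" by blast
    moreover have "coact (c *\<^sub>Q x + z) = c *\<^sub>Q coact x + coact z"
      by (simp add: coact_def lin_add lin_scaleQ)
    ultimately show ?case
      using step(2) by (metis (no_types, lifting) ratv.span_add ratv.span_scale)
  qed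
qed

lemma J_MT_largest: "motivic_relations R \<Longrightarrow> R \<subseteq> J_MT"
  unfolding J_MT_def by (auto intro: ratv.span_base)

lemma per_one: "per 1 = 1"
proof -
  have e: "{ks :: nat list. length ks = length ([] :: nat list) \<and> sorted_wrt (<) (0 # ks)} = {[]}"
    by auto
  have "mzv [] = 1" unfolding mzv_def e by simp
  then have "per_adm [] = 1" by (simp add: per_adm_def)
  then show ?thesis by (simp add: per_def reg_left_def reg_right_def lin_one)
qed

lemma J_MT_add: "x \<in> J_MT \<Longrightarrow> y \<in> J_MT \<Longrightarrow> x + y \<in> J_MT"
  by (simp add: J_MT_def ratv.span_add)

lemma J_MT_scaleQ: "x \<in> J_MT \<Longrightarrow> c *\<^sub>Q x \<in> J_MT"
  by (simp add: J_MT_def ratv.span_scale)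

lemma J_MT_diff: "x \<in> J_MT \<Longrightarrow> y \<in> J_MT \<Longrightarrow> x - y \<in> J_MT"
  by (simp add: J_MT_def ratv.span_diff)

lemma J_MT_uminus: "x \<in> J_MT \<Longrightarrow> - x \<in> J_MT"
  by (simp add: J_MT_def ratv.span_neg)

quotient_type mmzv = "bool shuf" / "\<lambda>x y. x - y \<in> J_MT"
proof (rule equivpI)
  show "reflp (\<lambda>x y. x - y \<in> J_MT)" by (simp add: reflp_def J_MT_def ratv.span_zero)
  show "symp (\<lambda>x y. x - y \<in> J_MT)" using J_MT_uminus by (force simp: symp_def)
  show "transp (\<lambda>x y. x - y \<in> J_MT)" using J_MT_add by (force simp: transp_def)
qed

instantiation mmzv :: rat_algebra_1
begin

lift_definition zero_mmzv :: mmzv is 0 .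
lift_definition one_mmzv :: mmzv is 1 .
lift_definition plus_mmzv :: "mmzv \<Rightarrow> mmzv \<Rightarrow> mmzv" is "(+)"
  using J_MT_add by (force simp: algebra_simps)
lift_definition uminus_mmzv :: "mmzv \<Rightarrow> mmzv" is uminus
  using J_MT_uminus by force
lift_definition minus_mmzv :: "mmzv \<Rightarrow> mmzv \<Rightarrow> mmzv" is "(-)"
  using J_MT_diff by (force simp: algebra_simps)
lift_definition times_mmzv :: "mmzv \<Rightarrow> mmzv \<Rightarrow> mmzv" is "(*)"
proof -
  fix x x' y y' :: "bool shuf" assume "x - x' \<in> J_MT" "y - y' \<in> J_MT"
  then have "y * (x - x') + x' * (y - y') \<in> J_MT" by (intro J_MT_add J_MT_mult)
  then show "x * y - x' * y' \<in> J_MT" by (simp add: algebra_simps)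
qed
lift_definition scaleQ_mmzv :: "rat \<Rightarrow> mmzv \<Rightarrow> mmzv" is scaleQ
  using J_MT_scaleQ by (metis ratv.scale_right_diff_distrib)

instance
proof
  have z: "0 \<in> J_MT" by (simp add: J_MT_def ratv.span_zero)
  fix x y w :: mmzv and c d :: rat
  show "x * y * w = x * (y * w)" by transfer (simp add: z mult.assoc)
  show "x * y = y * x" by transfer (simp add: z mult.commute)
  show "1 * x = x" by transfer (simp add: z)
  show "(x + y) * w = x * w + y * w" by transfer (simp add: z distrib_right)
  show "x + y + w = x + (y + w)" by transfer (simp add: z add.assoc)
  show "x + y = y + x" by transfer (simp add: z add.commute)
  show "0 + x = x" by transfer (simp add: z)
  show "- x + x = 0" by transfer (simp add: z)
  show "x - y = x + - y" by transfer (simp add: z)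
  show "c *\<^sub>Q (x + y) = c *\<^sub>Q x + c *\<^sub>Q y" by transfer (simp add: z scaleQ_add_right)
  show "(c + d) *\<^sub>Q x = c *\<^sub>Q x + d *\<^sub>Q x" by transfer (simp add: z scaleQ_add_left)
  show "c *\<^sub>Q (d *\<^sub>Q x) = (c * d) *\<^sub>Q x" by transfer (simp add: z)
  show "1 *\<^sub>Q x = x" by transfer (simp add: z)
  show "(c *\<^sub>Q x) * y = c *\<^sub>Q (x * y)" by transfer (simp add: z mult_scaleQ_left)
  show "(0::mmzv) \<noteq> 1"
  proof (transfer, rule notI)
    assume "0 - 1 \<in> J_MT"
    then have "- (0 - 1) \<in> J_MT" by (rule J_MT_uminus)
    then show False using J_MT_per[of 1] per_one by simp
  qed
qed

end

lift_definition I_mot :: "bool \<Rightarrow> bool list \<Rightarrow> bool \<Rightarrow> mmzv" is II .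

definition H_deg :: "nat \<Rightarrow> mmzv set" where
  "H_deg n = spanQ {I_mot x w y | x w y. length w = n}"

definition zeta_m :: "nat \<Rightarrow> mmzv" where
  "zeta_m n = - I_mot False (True # replicate (n - 1) False) True"

definition zeta_m2 :: "nat \<Rightarrow> nat \<Rightarrow> mmzv" where
  "zeta_m2 a b = I_mot False (True # replicate (a - 1) False @ True # replicate (b - 1) False) True"

text \<open>
  \<open>(l \<otimes> id) \<circ> D\<^sub>r\<close> on \<open>I\<^sup>m(x; w; y)\<close>, for a linear form \<open>l\<close> on the
  indecomposables \<open>L\<^sub>r\<close>. Here \<open>l\<close> is given by its composite with the projection
  of the degree \<open>r\<close> part of \<open>mmzv\<close> onto \<open>L\<^sub>r\<close>, and is only evaluated on that part.
\<close>

definition D_contract :: "(mmzv \<Rightarrow> rat) \<Rightarrow> nat \<Rightarrow> bool \<Rightarrow> bool list \<Rightarrow> bool \<Rightarrow> mmzv" where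
  "D_contract l r x w y = (let s = x # w @ [y] in
     \<Sum>p = 0..length w - r.
       l (I_mot (s ! p) (take r (drop p w)) (s ! (p + r + 1))) *\<^sub>Q
       I_mot x (take p w @ drop (p + r) w) y)"


section \<open>The f-alphabet\<close>

text \<open>
  The letter \<open>k :: nat\<close> stands for \<open>f\<^bsub>2k+3\<^esub>\<close>, so that \<open>nat shuf\<close> is the shuffle algebra
  \<open>U'\<close>; and \<open>U = U' \<otimes> \<rat>[f\<^sub>2]\<close> is the polynomial ring over \<open>U'\<close> in the variable \<open>f\<^sub>2\<close>.
  Operators on words are extended linearly over \<open>\<rat>[f\<^sub>2]\<close> by \<open>map_poly\<close>. The index \<open>r\<close>
  in \<open>letter\<close>, \<open>f_odd\<close>, \<open>del_f\<close>, \<open>c_f\<close> is always odd and at least 3.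
\<close>

type_synonym f_alphabet = "nat shuf poly"

definition letter :: "nat \<Rightarrow> nat" where
  "letter r = (r - 3) div 2"

definition f_odd :: "nat \<Rightarrow> f_alphabet" where
  "f_odd r = [:word [letter r]:]"

definition f_two :: f_alphabet where
  "f_two = [:0, 1:]"

definition wt :: "nat list \<Rightarrow> nat" where
  "wt ks = (\<Sum>k\<leftarrow>ks. 2 * k + 3)"

definition U_deg :: "nat \<Rightarrow> f_alphabet set" where
  "U_deg n = {u. \<forall>i ks. wcoeff (coeff u i) ks \<noteq> 0 \<longrightarrow> wt ks + 2 * i = n}"

definition del_f :: "nat \<Rightarrow> f_alphabet \<Rightarrow> f_alphabet" where
  "del_f r = map_poly (lin (\<lambda>ks. case ks of [] \<Rightarrow> 0
     | k # ks' \<Rightarrow> if k = letter r then word ks' else 0))"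

definition c_f :: "nat \<Rightarrow> f_alphabet \<Rightarrow> rat" where
  "c_f r u = wcoeff (coeff u 0) [letter r]"

definition normalized_iso :: "(mmzv \<Rightarrow> f_alphabet) \<Rightarrow> bool" where
  "normalized_iso \<phi> \<longleftrightarrow>
     bij \<phi> \<and> rat_alg_hom \<phi> \<and> (\<forall>n. \<phi> ` H_deg n = U_deg n) \<and>
     \<phi> (zeta_m 2) = f_two \<and> (\<forall>n\<ge>1. \<phi> (zeta_m (2 * n + 1)) = f_odd (2 * n + 1)) \<and>
     (\<forall>r x w y. odd r \<and> r \<ge> 3 \<and> length w \<ge> r + 2 \<longrightarrow>
        inv \<phi> (del_f r (\<phi> (I_mot x w y))) = D_contract (c_f r \<circ> \<phi>) r x w y)"


section \<open>The group action and minimal motives\<close>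

text \<open>The rational points of \<open>Spec U'\<close>.\<close>

definition U_dR :: "(nat shuf \<Rightarrow> rat) set" where
  "U_dR = {g. rat_alg_hom g}"

definition unip_act :: "(nat shuf \<Rightarrow> rat) \<Rightarrow> f_alphabet \<Rightarrow> f_alphabet" where
  "unip_act g = map_poly (lin (\<lambda>ks. \<Sum>m\<le>length ks. g (word (drop m ks)) *\<^sub>Q word (take m ks)))"

definition Gm_act :: "rat \<Rightarrow> f_alphabet \<Rightarrow> f_alphabet" where
  "Gm_act t u = (\<Sum>i\<le>degree u. monom (lin (\<lambda>ks. t ^ (wt ks + 2 * i) *\<^sub>Q word ks) (coeff u i)) i)"

definition G_orbit :: "(mmzv \<Rightarrow> f_alphabet) \<Rightarrow> mmzv \<Rightarrow> mmzv set" where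
  "G_orbit \<phi> z = {inv \<phi> (unip_act g (Gm_act t (\<phi> z))) | g t. g \<in> U_dR \<and> t \<noteq> 0}"

text \<open>
  The group is the semidirect product of a prounipotent group and the multiplicative group over
  the rationals, so its rational points are Zariski dense and the span of the orbit under them is
  the subrepresentation generated by the vector.
\<close>

definition V_mot :: "(mmzv \<Rightarrow> f_alphabet) \<Rightarrow> nat \<Rightarrow> nat \<Rightarrow> mmzv set" where
  "V_mot \<phi> a b = spanQ (G_orbit \<phi> (zeta_m2 a b))"

definition V_deg :: "(mmzv \<Rightarrow> f_alphabet) \<Rightarrow> nat \<Rightarrow> nat \<Rightarrow> nat \<Rightarrow> mmzv set" where
  "V_deg \<phi> a b n = V_mot \<phi> a b \<inter> H_deg n"

definition I_set :: "nat \<Rightarrow> nat \<Rightarrow> nat set" where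
  "I_set a b =
     (if a = b then {0, a, 2 * a}
      else if b < a then {i. odd i \<and> i \<ge> 3 \<and> b \<le> i \<and> i \<le> a + b - 2} \<union> {0, a + b}
      else {i. odd i \<and> i \<ge> 3 \<and> a + 1 \<le> i \<and> i \<le> a + b - 2} \<union> {0, a + b})"

definition J_set :: "nat \<Rightarrow> nat \<Rightarrow> nat set" where
  "J_set a b = (\<lambda>i. a + b - i) ` I_set a b"

end

(* The operators D_r determine an element of degree N in the f-alphabet up to f_2^(N/2) (N even) or
   f_N (N odd).  On zeta(a,b) one finds D_r = c_r zeta(r) (x) zeta(N-r) with
   c_r = [r=a] + (-1)^a C(r-1,a-1) - (-1)^b C(r-1,b-1), and c_r is nonzero exactly when r (N even),
   or N - r (N odd), occurs among the inner degrees.  Hence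
   zeta(a,b) = sum_r c_r f_r f_{N-r} + k f_2^(N/2) for even N, and
   zeta(a,b) = sum_r c_r f_r zeta(N-r) + c f_N with zeta(N-r) a multiple of f_2^((N-r)/2) for odd N;
   acting by suitable characters of the shuffle algebra isolates the single summands.  For odd N
   the constants lie in the span because c is nonzero, which is seen on real periods. *)

theory Submission
  imports Defs
begin

section \<open>Characters of the shuffle algebra\<close>

text \<open>The words that occur have at most two letters, so a point of the group matters only
  through its values on words of length one and two; exponentials of one letter, and one product of
  two such, supply the values required. The action cuts off final letters: from f_r f_{N-r} it keeps
  f_r, from f_r f_2^k it keeps f_2^k. This is why the inner degrees are r for even N and N - r for
  odd N.

  The obstacle is that \<open>mmzv\<close> is a quotient by the largest admissible ideal, whose
  elements are hard to exhibit. Relations are therefore taken from the shuffle product and from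
  \<phi>: the f-alphabet has nothing in degree 1, and an element is known once its coefficients on
  words are. The ideal itself enters through one property, the vanishing of its periods, and only to
  see that c is nonzero.

  The three terms of c_r belong to the three positions where a subword containing a 1 has different
  endpoints. For odd a the term [r=a] cancels a binomial coefficient at r = a, which makes the index
  sets for b < a and b > a differ.\<close>

lemma shuf_eqI: "(\<And>w. wcoeff x w = wcoeff y w) \<Longrightarrow> x = y"
  by (simp add: wcoeff_inject[symmetric] fun_eq_iff)

lemma wcoeff_simps [simp]:
  "wcoeff (x + y) w = wcoeff x w + wcoeff y w"
  "wcoeff (x - y) w = wcoeff x w - wcoeff y w"
  "wcoeff (- x) w = - wcoeff x w"
  "wcoeff (c *\<^sub>Q x) w = c * wcoeff x w"
  "wcoeff 0 w = 0"
  "wcoeff (word v) w = (if w = v then 1 else 0)"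
  "wcoeff 1 w = (if w = [] then 1 else 0)"
  "wcoeff (x * y) w = shuffle_mult (wcoeff x) (wcoeff y) w"
  by (simp_all add: plus_shuf.rep_eq minus_shuf.rep_eq uminus_shuf.rep_eq scaleQ_shuf.rep_eq zero_shuf.rep_eq
      word.rep_eq one_shuf.rep_eq times_shuf.rep_eq)

lemma wcoeff_sum: "wcoeff (sum f A) w = (\<Sum>i\<in>A. wcoeff (f i) w)"
  by (induction A rule: infinite_finite_induct) simp_all

lemma lin_word_id: "lin word x = x"
proof (rule shuf_eqI)
  fix w
  have "wcoeff (lin word x) w = (\<Sum>v\<in>supp x. if w = v then wcoeff x v else 0)"
    unfolding lin_def wcoeff_sum by (intro sum.cong) auto
  then show "wcoeff (lin word x) w = wcoeff x w"
    by (simp add: finite_supp) (simp add: supp_def)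
qed

lemma shuf_linear_eqI:
  assumes "\<And>x y. F (x + y) = F x + F y" "\<And>c x. F (c *\<^sub>Q x) = c *\<^sub>Q F x"
    and "\<And>x y. G (x + y) = G x + G y" "\<And>c x. G (c *\<^sub>Q x) = c *\<^sub>Q G x"
    and "\<And>w. F (word w) = (G (word w) :: 'b::rat_vector)"
  shows "F x = G x"
proof -
  have z: "F 0 = 0" "G 0 = 0" using assms(2,4)[of 0 0] by simp_all
  have s: "F (sum f A) = (\<Sum>i\<in>A. F (f i))" "G (sum f A) = (\<Sum>i\<in>A. G (f i))"
    for f :: "'a list \<Rightarrow> 'a shuf" and A
    by (induction A rule: infinite_finite_induct) (simp_all add: assms z)
  have "F (lin word x) = G (lin word x)"
    unfolding lin_def by (simp add: s assms)
  then show ?thesis by (simp add: lin_word_id)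
qed

lemma prefix_letter_word: "prefix_letter a (word w) = word (a # w)"
  by (rule shuf_eqI) (auto simp: prefix_letter.rep_eq split: list.split)

lemma prefix_letter_add: "prefix_letter a (x + y) = prefix_letter a x + prefix_letter a y"
  by (rule shuf_eqI) (auto simp: prefix_letter.rep_eq split: list.split)

lemma prefix_letter_scaleQ: "prefix_letter a (c *\<^sub>Q x) = c *\<^sub>Q prefix_letter a x"
  by (rule shuf_eqI) (auto simp: prefix_letter.rep_eq split: list.split)

lemma coeff_scaleQ [simp]: "coeff (c *\<^sub>Q p) n = c *\<^sub>Q coeff p n"
  by (simp add: scaleQ_poly_def coeff_map_poly)

section \<open>Exponentials of a single letter\<close>

lemma shuffle_mult_replicate:
  "shuffle_mult f g (replicate n k) =
     (\<Sum>i\<le>n. of_nat (n choose i) * f (replicate i k) * g (replicate (n - i) k))"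
proof (induction n arbitrary: f g)
  case (Suc n)
  let ?T = "\<lambda>i. f (replicate i k) * g (replicate (Suc n - i) k)"
  have "shuffle_mult f g (replicate (Suc n) k) =
      (\<Sum>i\<le>n. of_nat (n choose i) * f (k # replicate i k) * g (replicate (n - i) k)) +
      (\<Sum>i\<le>n. of_nat (n choose i) * f (replicate i k) * g (k # replicate (n - i) k))"
    by (simp add: Suc.IH)
  also have "(\<Sum>i\<le>n. of_nat (n choose i) * f (replicate i k) * g (k # replicate (n - i) k)) =
      (\<Sum>i\<le>n. of_nat (n choose i) * ?T i)"
    by (intro sum.cong) (auto simp: Suc_diff_le)
  also have "\<dots> = (\<Sum>i\<le>Suc n. of_nat (n choose i) * ?T i)"
    by (simp add: binomial_eq_0)
  also have "(\<Sum>i\<le>Suc n. of_nat (n choose i) * ?T i) =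
      ?T 0 + (\<Sum>i\<le>n. of_nat (n choose Suc i) * ?T (Suc i))"
    by (subst sum.atMost_Suc_shift) simp
  finally have "shuffle_mult f g (replicate (Suc n) k) =
      ?T 0 + (\<Sum>i\<le>n. of_nat (Suc n choose Suc i) * ?T (Suc i))"
    by (simp add: sum.distrib algebra_simps)
  also have "\<dots> = (\<Sum>i\<le>Suc n. of_nat (Suc n choose i) * ?T i)"
    by (subst sum.atMost_Suc_shift[where n = n]) simp
  finally show ?case by (simp only: mult.assoc)
qed simp

text \<open>Restriction of functions on the group to the one-parameter subgroup exp(T e_k), with e_k
  dual to the letter k: powers of k become divided powers of T, and words with another letter
  vanish.\<close>

definition letter_poly :: "'a \<Rightarrow> 'a shuf \<Rightarrow> rat poly" where
  "letter_poly k = lin (\<lambda>w. if w = replicate (length w) k then monom (1 / fact (length w)) (length w) else 0)"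

lemma coeff_letter_poly: "coeff (letter_poly k x) n = wcoeff x (replicate n k) / fact n"
proof -
  have "coeff (letter_poly k x) n = (\<Sum>w\<in>supp x. if w = replicate n k then wcoeff x w / fact n else 0)"
    unfolding letter_poly_def lin_def coeff_sum
    by (intro sum.cong) (auto simp: scaleQ_rat_def)
  also have "\<dots> = wcoeff x (replicate n k) / fact n"
    by (simp add: sum.delta finite_supp) (auto simp: supp_def)
  finally show ?thesis .
qed

text \<open>The word k^n arises only from k^i and k^(n-i), in binomially many ways; division by n!
  turns this into the Cauchy product.\<close>

lemma letter_poly_mult: "letter_poly k (x * y) = letter_poly k x * letter_poly k y"
proof (rule poly_eqI)
  fix n
  show "coeff (letter_poly k (x * y)) n = coeff (letter_poly k x * letter_poly k y) n"
    unfolding coeff_mult coeff_letter_poly wcoeff_simps shuffle_mult_replicate sum_divide_distrib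
    by (intro sum.cong) (auto simp: binomial_fact field_simps)
qed

text \<open>The rational point exp(t e_k) of the group.\<close>

definition exp_char :: "'a \<Rightarrow> rat \<Rightarrow> 'a shuf \<Rightarrow> rat" where
  "exp_char k t x = poly (letter_poly k x) t"

lemma exp_char_word: "exp_char k t (word w) =
    (if w = replicate (length w) k then t ^ length w / fact (length w) else 0)"
  by (simp add: exp_char_def letter_poly_def lin_word poly_monom)

lemma rat_alg_hom_exp_char: "rat_alg_hom (exp_char k t)"
proof -
  have 1: "letter_poly k (x + y) = letter_poly k x + letter_poly k y" for x y :: "'a shuf"
    by (simp add: letter_poly_def lin_add)
  have 2: "letter_poly k (c *\<^sub>Q x) = smult c (letter_poly k x)" for c and x :: "'a shuf"
    by (rule poly_eqI) (simp add: letter_poly_def lin_scaleQ scaleQ_rat_def)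
  have "exp_char k t 1 = 1"
    by (simp add: word_Nil[symmetric] exp_char_word)
  then show ?thesis
    by (simp add: rat_alg_hom_def exp_char_def 1 2 letter_poly_mult scaleQ_rat_def)
qed

section \<open>Translation of functions by a point of the group\<close>

definition right_translate :: "('a shuf \<Rightarrow> rat) \<Rightarrow> 'a shuf \<Rightarrow> 'a shuf" where
  "right_translate g = lin (\<lambda>ks. \<Sum>m\<le>length ks. g (word (drop m ks)) *\<^sub>Q word (take m ks))"

text \<open>Strips the prefix \<open>u\<close> and drops all words without it. For a single letter
  this is the derivation behind the recursion of \<open>shuffle_mult\<close>.\<close>

lift_definition shift :: "'a list \<Rightarrow> 'a shuf \<Rightarrow> 'a shuf" is "\<lambda>u f v. f (u @ v)"
proof -
  fix u :: "'a list" and f :: "'a list \<Rightarrow> rat" assume "finite {w. f w \<noteq> 0}"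
  then have "finite ((@) u -` {w. f w \<noteq> 0})" by (rule finite_vimageI) (simp add: inj_def)
  then show "finite {v. f (u @ v) \<noteq> 0}" by (simp add: vimage_def)
qed

lemma shift_add: "shift u (x + y) = shift u x + shift u y"
  by (rule shuf_eqI) (simp add: shift.rep_eq)

lemma shift_scaleQ: "shift u (c *\<^sub>Q x) = c *\<^sub>Q shift u x"
  by (rule shuf_eqI) (simp add: shift.rep_eq)

lemma shift_Nil: "shift [] x = x"
  by (rule shuf_eqI) (simp add: shift.rep_eq)

lemma shift_Cons: "shift (a # u) x = shift u (shift [a] x)"
  by (rule shuf_eqI) (simp add: shift.rep_eq)

lemma shift_mult: "shift [a] (x * y) = shift [a] x * y + x * shift [a] y"
  by (rule shuf_eqI) (simp add: shift.rep_eq[abs_def])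

lemma shift_word: "shift u (word w) = (if take (length u) w = u then word (drop (length u) w) else 0)"
  by (rule shuf_eqI) (auto simp: shift.rep_eq append_eq_conv_conj)

lemma rat_alg_homD:
  assumes "rat_alg_hom h"
  shows "h (x + y) = h x + h y" "h (c *\<^sub>Q x) = c *\<^sub>Q h x" "h (x * y) = h x * h y" "h 1 = 1" "h 0 = 0"
    "h (x - y) = h x - h y" "h (- x) = - h x"
proof -
  show a: "h (x + y) = h x + h y" "h (c *\<^sub>Q x) = c *\<^sub>Q h x" "h (x * y) = h x * h y" "h 1 = 1" for x y c
    using assms by (auto simp: rat_alg_hom_def)
  show "h 0 = 0" using a(2)[of 0 0] by simp
  show m: "h (- x) = - h x" for x using a(2)[of "-1" x] by (simp add: ratv.scale_minus_left scaleQ_one)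
  show "h (x - y) = h x - h y" using a(1)[of x "- y"] m by simp
qed

lemma right_translate_add: "right_translate g (x + y) = right_translate g x + right_translate g y"
  by (simp add: right_translate_def lin_add)

lemma right_translate_scaleQ: "right_translate g (c *\<^sub>Q x) = c *\<^sub>Q right_translate g x"
  by (simp add: right_translate_def lin_scaleQ)

lemma right_translate_zero: "right_translate g 0 = 0"
  by (simp add: right_translate_def lin_zero)

lemma right_translate_word:
  "right_translate g (word ks) = (\<Sum>m\<le>length ks. g (word (drop m ks)) *\<^sub>Q word (take m ks))"
  by (simp add: right_translate_def lin_word)

text \<open>Among the cuts of a word only the one at \<open>length u\<close> can contribute to the
  coefficient of \<open>u\<close>, and it does so if the word begins with \<open>u\<close>;
  \<open>g\<close> is then evaluated on the rest.\<close>

lemma wcoeff_right_translate: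
  assumes "rat_alg_hom g"
  shows "wcoeff (right_translate g x) u = g (shift u x)"
proof (rule shuf_linear_eqI[of _ "\<lambda>x. g (shift u x)"])
  fix w
  show "wcoeff (right_translate g (word w)) u = g (shift u (word w))"
  proof -
    have "wcoeff (right_translate g (word w)) u =
        (\<Sum>m\<le>length w. if u = take m w then g (word (drop m w)) else 0)"
      unfolding right_translate_word wcoeff_sum by (intro sum.cong) auto
    also have "\<dots> = (\<Sum>m\<le>length w. if m = length u then
        (if take (length u) w = u then g (word (drop (length u) w)) else 0) else 0)"
      by (intro sum.cong) (auto simp: min_def)
    also have "\<dots> = g (shift u (word w))"
      by (auto simp: shift_word rat_alg_homD(5)[OF assms] sum.delta min_def dest: arg_cong[where f = length])
    finally show ?thesis .
  qed
qed (simp_all add: right_translate_add right_translate_scaleQ shift_add shift_scaleQ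
    rat_alg_homD(1,2)[OF assms] scaleQ_rat_def)

text \<open>Read through \<open>wcoeff_right_translate\<close>, the shuffle recursion on words is preserved by any
  algebra homomorphism; this replaces the compatibility of shuffle and deconcatenation.\<close>

lemma right_translate_mult:
  assumes "rat_alg_hom g"
  shows "right_translate g (x * y) = right_translate g x * right_translate g y"
proof (rule shuf_eqI)
  fix u
  have "g (shift u (x * y)) = shuffle_mult (\<lambda>u. g (shift u x)) (\<lambda>u. g (shift u y)) u"
  proof (induction u arbitrary: x y)
    case Nil
    show ?case by (simp add: shift_Nil rat_alg_homD[OF assms])
  next
    case (Cons a u)
    have e: "(\<lambda>u. g (shift (a # u) z)) = (\<lambda>u. g (shift u (shift [a] z)))" for z
      by (rule ext) (subst shift_Cons, rule refl)
    show ?case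
      unfolding shift_Cons[of a u] shift_mult shift_add rat_alg_homD(1)[OF assms] Cons.IH
      by (simp only: shuffle_mult.simps e)
  qed
  then show "wcoeff (right_translate g (x * y)) u = wcoeff (right_translate g x * right_translate g y) u"
    by (simp add: wcoeff_right_translate[OF assms] wcoeff_right_translate[OF assms, abs_def])
qed

text \<open>Multiplication in the group: \<open>g\<close> is evaluated on initial parts of words,
  \<open>h\<close> on final parts.\<close>

lemma rat_alg_hom_convolution:
  assumes "rat_alg_hom g" "rat_alg_hom h"
  shows "rat_alg_hom (g \<circ> right_translate h)"
proof -
  have "right_translate h 1 = 1"
    by (simp add: word_Nil[symmetric] right_translate_word)
      (simp add: word_Nil rat_alg_homD[OF assms(2)] scaleQ_one)
  then show ?thesis
    by (simp add: rat_alg_hom_def right_translate_add right_translate_scaleQ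
        right_translate_mult[OF assms(2)] rat_alg_homD[OF assms(1)])
qed

section \<open>The derivations on single and double zeta values\<close>

lemma abs_mmzv_add: "abs_mmzv (x + y) = abs_mmzv x + abs_mmzv y"
  by (simp add: plus_mmzv.abs_eq)

lemma abs_mmzv_mult: "abs_mmzv (x * y) = abs_mmzv x * abs_mmzv y"
  by (simp add: times_mmzv.abs_eq)

lemma abs_mmzv_scaleQ: "abs_mmzv (c *\<^sub>Q x) = c *\<^sub>Q abs_mmzv x"
  by (simp add: scaleQ_mmzv.abs_eq)

lemma I_mot_word: "I_mot False w True = abs_mmzv (word w)"
  by (simp add: I_mot.abs_eq II_def word_Nil)

lemma I_mot_Nil: "I_mot x [] y = 1"
  by (simp add: I_mot.abs_eq II_def one_mmzv.abs_eq)

lemma I_mot_loop: "x = y \<Longrightarrow> w \<noteq> [] \<Longrightarrow> I_mot x w y = 0"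
  by (simp add: I_mot.abs_eq II_def zero_mmzv.abs_eq)

lemma I_mot_reverse: "I_mot True w False = (-1) ^ length w *\<^sub>Q I_mot False (rev w) True"
  by (simp add: I_mot.abs_eq II_def abs_mmzv_scaleQ[symmetric] scaleQ_one)

lemma word_Cons_mult_single:
  "word [a] * word (b # v) = word (a # b # v) + prefix_letter b (word [a] * word v)"
  by (simp add: word_Cons_mult word_Nil prefix_letter_word)

lemma scaleQ_Suc: "of_nat (Suc n) *\<^sub>Q x = x + of_nat n *\<^sub>Q x"
  by (simp add: scaleQ_add_left scaleQ_one)

lemma word_False_mult_replicate:
  "word [False] * word (replicate n False) = of_nat (Suc n) *\<^sub>Q word (replicate (Suc n) False)"
proof (induction n)
  case 0
  show ?case by (simp add: word_Nil scaleQ_one)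
next
  case (Suc n)
  then show ?case
    by (simp add: word_Cons_mult_single prefix_letter_scaleQ prefix_letter_word
        scaleQ_Suc[of "Suc n"] del: of_nat_Suc)
qed

text \<open>The inserted 0 lands in one of k + 1 places before the 1 or in one of n + 1 places after
  it.\<close>

lemma word_False_mult_single_True:
  "word [False] * word (replicate k False @ True # replicate n False) =
     of_nat (Suc k) *\<^sub>Q word (replicate (Suc k) False @ True # replicate n False) +
     of_nat (Suc n) *\<^sub>Q word (replicate k False @ True # replicate (Suc n) False)"
proof (induction k)
  case 0
  show ?case
    by (simp add: word_Cons_mult_single word_False_mult_replicate prefix_letter_scaleQ
        prefix_letter_word scaleQ_one of_nat_1[unfolded One_nat_def] del: of_nat_Suc)
next
  case (Suc k)
  then show ?case
    by (simp add: word_Cons_mult_single prefix_letter_scaleQ prefix_letter_add prefix_letter_word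
        scaleQ_Suc[of "Suc k"] del: of_nat_Suc)
qed

lemma U_deg_subspace:
  "0 \<in> U_deg n" "u \<in> U_deg n \<Longrightarrow> v \<in> U_deg n \<Longrightarrow> u + v \<in> U_deg n"
  "u \<in> U_deg n \<Longrightarrow> c *\<^sub>Q u \<in> U_deg n"
  by (auto simp: U_deg_def) (metis add_0)

lemma U_deg_1: "U_deg 1 = {0}"
proof -
  have "u = 0" if "u \<in> U_deg 1" for u
  proof (intro poly_eqI shuf_eqI)
    fix i ks
    have "wt ks + 2 * i \<noteq> 1" by (cases ks) (auto simp: wt_def)
    then show "wcoeff (coeff u i) ks = wcoeff (coeff 0 i) ks"
      using that by (auto simp: U_deg_def)
  qed
  then show ?thesis using U_deg_subspace(1) by auto
qed

text \<open>The three terms are the contributions to D_r of the subwords at the positions 0, 1 and a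
  + b - r.\<close>

definition zeta2_coeff :: "nat \<Rightarrow> nat \<Rightarrow> nat \<Rightarrow> rat" where
  "zeta2_coeff a b r = (if r = a then 1 else 0) + (-1) ^ a * of_nat ((r - 1) choose (a - 1)) -
     (-1) ^ b * of_nat ((r - 1) choose (b - 1))"

section \<open>Consequences of a normalized isomorphism\<close>

locale normalized =
  fixes \<phi> :: "mmzv \<Rightarrow> f_alphabet"
  assumes normalized: "normalized_iso \<phi>"
begin

lemma bij_phi: "bij \<phi>" and hom_phi: "rat_alg_hom \<phi>" and phi_H_deg: "\<phi> ` H_deg n = U_deg n"
  using normalized unfolding normalized_iso_def by auto

lemma phi_zeta_odd:
  assumes "odd r" "3 \<le> r" shows "\<phi> (zeta_m r) = f_odd r"
proof -
  from assms(1) obtain n where "r = 2 * n + 1" by (elim oddE)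
  moreover from this have "n \<ge> 1" using assms(2) by simp
  ultimately show ?thesis using normalized unfolding normalized_iso_def by auto
qed

lemmas phi_simps = rat_alg_homD[OF hom_phi]

lemma phi_sum: "\<phi> (sum f A) = (\<Sum>i\<in>A. \<phi> (f i))"
  by (induction A rule: infinite_finite_induct) (simp_all add: phi_simps)

lemma inj_phi: "inj \<phi>"
  using bij_phi by (rule bij_is_inj)

lemma inv_phi_phi [simp]: "inv \<phi> (\<phi> x) = x"
  using inj_phi by simp

lemma phi_inv_phi [simp]: "\<phi> (inv \<phi> u) = u"
  using bij_phi by (simp add: bij_is_surj surj_f_inv_f)

lemma inv_phi_eqI: "u = \<phi> x \<Longrightarrow> inv \<phi> u = x"
  by simp

lemma H_deg_iff: "x \<in> H_deg n \<longleftrightarrow> \<phi> x \<in> U_deg n"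
  using phi_H_deg[of n] inj_phi by (metis inj_image_mem_iff)

lemma del_f_phi:
  "odd r \<Longrightarrow> r \<ge> 3 \<Longrightarrow> length w \<ge> r + 2 \<Longrightarrow>
    del_f r (\<phi> (I_mot x w y)) = \<phi> (D_contract (c_f r \<circ> \<phi>) r x w y)"
  using normalized unfolding normalized_iso_def by (metis phi_inv_phi)

text \<open>The existence of \<open>\<phi>\<close> already forces degree 1 to vanish; no relation has to be verified
  through the definition of \<open>J_MT\<close>.\<close>

lemma I_mot_degree_1: "I_mot x [e] y = 0"
proof -
  have "I_mot x [e] y \<in> H_deg 1"
    unfolding H_deg_def by (rule ratv.span_base) force
  then have "\<phi> (I_mot x [e] y) = \<phi> 0"
    by (simp add: H_deg_iff U_deg_1[unfolded One_nat_def] phi_simps)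
  then show ?thesis using inj_phi by (simp add: inj_eq)
qed

lemma abs_word_False: "abs_mmzv (word [False]) = 0"
  using I_mot_degree_1[of False False True] by (simp add: I_mot_word)

text \<open>Up to the factor n, the word 0^n is the shuffle product of 0^(n-1) with the letter 0,
  whose integral has degree 1 and vanishes.\<close>

lemma I_mot_zeros:
  assumes "n > 0" shows "I_mot x (replicate n False) y = 0"
proof -
  from assms obtain m where n: "n = Suc m" by (cases n) auto
  have "of_nat (Suc m) *\<^sub>Q abs_mmzv (word (replicate (Suc m) False)) = 0"
    unfolding abs_mmzv_scaleQ[symmetric] word_False_mult_replicate[symmetric] abs_mmzv_mult
    by (simp add: abs_word_False)
  then have "I_mot False (replicate n False) True = 0"
    by (simp add: I_mot_word n del: of_nat_Suc replicate.simps)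
  then show ?thesis
    using assms by (cases x; cases y) (simp_all add: I_mot_loop I_mot_reverse)
qed

text \<open>Shuffling with the vanishing letter 0 gives a relation that moves one zero across the 1;
  induction on k collects the ratios of the multiplicities into a binomial coefficient.\<close>

lemma I_mot_single_True:
  "I_mot False (replicate k False @ True # replicate n False) True =
     - (((-1) ^ k * of_nat (n + k choose k)) *\<^sub>Q zeta_m (Suc (n + k)))"
proof (induction k arbitrary: n)
  case 0
  show ?case by (simp add: zeta_m_def scaleQ_one)
next
  case (Suc k)
  let ?X = "\<lambda>k n. I_mot False (replicate k False @ True # replicate n False) True"
  have "of_nat (Suc k) *\<^sub>Q ?X (Suc k) n + of_nat (Suc n) *\<^sub>Q ?X k (Suc n) = 0"
    unfolding I_mot_word abs_mmzv_scaleQ[symmetric] abs_mmzv_add[symmetric]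
      word_False_mult_single_True[symmetric] abs_mmzv_mult
    by (simp add: abs_word_False)
  then have "of_nat (Suc k) *\<^sub>Q ?X (Suc k) n = - (of_nat (Suc n) *\<^sub>Q ?X k (Suc n))"
    by (simp add: eq_neg_iff_add_eq_0)
  also have "\<dots> = ((-1) ^ k * of_nat (Suc n * (Suc n + k choose k))) *\<^sub>Q zeta_m (Suc (n + Suc k))"
    unfolding Suc.IH by (simp add: algebra_simps)
  also have "Suc n * (Suc n + k choose k) = Suc k * (n + Suc k choose Suc k)"
    using Suc_times_binomial_add[of k n] by (simp add: add.commute)
  also have "((-1) ^ k * of_nat (Suc k * (n + Suc k choose Suc k))) *\<^sub>Q zeta_m (Suc (n + Suc k)) =
      of_nat (Suc k) *\<^sub>Q (- (((-1) ^ Suc k * of_nat (n + Suc k choose Suc k)) *\<^sub>Q zeta_m (Suc (n + Suc k))))"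
    by (simp add: algebra_simps)
  finally show ?case
    by (subst (asm) ratv.scale_cancel_left) simp
qed

text \<open>The subword at p = 0 has both endpoints 0, and every later one consists of
  zeros.\<close>

lemma D_zeta_m:
  assumes "1 \<le> r" "r + 2 \<le> n"
  shows "D_contract (c_f r \<circ> \<phi>) r False (True # replicate (n - 1) False) True = 0"
  unfolding D_contract_def Let_def
proof (rule sum.neutral, intro ballI)
  let ?w = "True # replicate (n - 1) False"
  let ?s = "False # ?w @ [True]"
  fix p assume "p \<in> {0..length ?w - r}"
  then have p: "p + r \<le> n" using assms by auto
  have "I_mot (?s ! p) (take r (drop p ?w)) (?s ! (p + r + 1)) = 0"
  proof (cases "p = 0")
    case True
    then have "?s ! p = ?s ! (p + r + 1)" "take r (drop p ?w) \<noteq> []"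
      using assms by (auto simp: nth_append)
    then show ?thesis by (rule I_mot_loop)
  next
    case False
    then have "take r (drop p ?w) = replicate r False"
      using p by (cases p) auto
    then show ?thesis using assms(1) by (simp only: I_mot_zeros)
  qed
  then show "(c_f r \<circ> \<phi>) (I_mot (?s ! p) (take r (drop p ?w)) (?s ! (p + r + 1))) *\<^sub>Q
      I_mot False (take p ?w @ drop (p + r) ?w) True = 0"
    by (simp add: phi_simps c_f_def)
qed

text \<open>A summand survives only if its subword contains a 1 and has different endpoints. What
  remains after removing the subword is then 1 0^(N-r-1), and the subword is evaluated by
  \<open>I_mot_single_True\<close>.\<close>

lemma D_zeta_m2:
  assumes "1 \<le> a" "2 \<le> b" "odd r" "3 \<le> r" "r + 2 \<le> a + b"
  shows "D_contract (c_f r \<circ> \<phi>) r False (True # replicate (a - 1) False @ True # replicate (b - 1) False) True =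
    zeta2_coeff a b r *\<^sub>Q zeta_m (a + b - r)"
proof -
  define w where "w = True # replicate (a - 1) False @ True # replicate (b - 1) False"
  define s where "s = False # w @ [True]"
  define N where "N = a + b"
  define l where "l = c_f r \<circ> \<phi>"
  define T where "T = (\<lambda>p. l (I_mot (s ! p) (take r (drop p w)) (s ! (p + r + 1))) *\<^sub>Q
      I_mot False (take p w @ drop (p + r) w) True)"
  have l_simps: "l (c *\<^sub>Q x) = c * l x" "l (- x) = - l x" "l 0 = 0" for c x
    by (simp_all add: l_def c_f_def phi_simps)
  have l_zeta: "l (zeta_m r) = 1"
    using assms by (simp add: l_def c_f_def phi_zeta_odd f_odd_def)
  have len: "length w = N" using assms by (simp add: w_def N_def)
  have nth_w: "w ! i = (i = 0 \<or> i = a)" if "i < N" for i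
    using that assms by (auto simp: w_def N_def nth_Cons' nth_append)
  \<comment> \<open>Positions in \<open>s\<close> are shifted by one against \<open>w\<close>: the
    ones sit at 1, a + 1 and N + 1.\<close>
  have s1: "s ! p = (p = 1 \<or> p = a + 1)" if "p \<le> N" for p
    using that nth_w[of "p - 1"] len by (cases p) (auto simp: s_def nth_append)
  have s2: "s ! (p + r + 1) = (p + r = a \<or> p + r = N)" if "p + r \<le> N" for p
    using that nth_w[of "p + r"] len assms by (auto simp: s_def nth_append)
  have zeros: "take r (drop p w) = replicate r False" if "p \<noteq> 0" "a < p \<or> p + r \<le> a" "p + r \<le> N" for p
    using that by (intro nth_equalityI) (auto simp: len nth_w)
  have T_zero: "T p = 0" if "I_mot (s ! p) (take r (drop p w)) (s ! (p + r + 1)) = 0" for p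
    unfolding T_def that by (simp add: l_simps)
  have r0: "0 < r" using assms by simp
  have loop: "T p = 0" if "s ! p = s ! (p + r + 1)" "p + r \<le> N" for p
  proof (rule T_zero)
    have "take r (drop p w) \<noteq> []" using that len r0 by auto
    then show "I_mot (s ! p) (take r (drop p w)) (s ! (p + r + 1)) = 0"
      by (rule I_mot_loop[OF that(1)])
  qed
  have T_zeros: "T p = 0" if "p \<noteq> 0" "a < p \<or> p + r \<le> a" "p + r \<le> N" for p
    by (rule T_zero) (simp only: zeros[OF that] I_mot_zeros[OF r0])
  have quot: "I_mot False (True # replicate (N - r - 1) False) True = - zeta_m (N - r)"
    by (simp add: zeta_m_def)
  have rN: "r + 2 \<le> N" using assms by (simp add: N_def)

  \<comment> \<open>The endpoints differ only for r = a; subword and remainder then each give minus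
    a single zeta, and the signs cancel.\<close>
  have T0: "T 0 = (if r = a then 1 else 0) *\<^sub>Q zeta_m (N - r)"
  proof (cases "r = a")
    case True
    have "take r (drop 0 w) = True # replicate (r - 1) False"
      using rN r0 True by (intro nth_equalityI) (auto simp: len nth_w nth_Cons')
    moreover have "s ! 0 = False" "s ! (0 + r + 1) = True"
      using s1[of 0] s2[of 0] rN True by auto
    moreover have "take 0 w @ drop (0 + r) w = True # replicate (N - r - 1) False"
      using rN r0 True by (intro nth_equalityI) (auto simp: len nth_w nth_Cons')
    moreover have "I_mot False (True # replicate (r - 1) False) True = - zeta_m r"
      by (simp add: zeta_m_def)
    ultimately have "T 0 = l (- zeta_m r) *\<^sub>Q (- zeta_m (N - r))"
      unfolding T_def by (simp only: quot)
    then show ?thesis using True l_zeta by (simp add: l_simps scaleQ_one)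
  next
    case False
    then have "T 0 = 0" using s1[of 0] s2[of 0] rN by (intro loop) auto
    then show ?thesis using False by simp
  qed
  have sgn: "(-1 :: rat) ^ r = -1" using assms by simp
  \<comment> \<open>The subword runs from 1 to 0, so it is reversed: the sign (-1)^r of the reversal
    times (-1)^(r-a) from the regularization is (-1)^a.\<close>
  have T1: "T 1 = ((-1) ^ a * of_nat ((r - 1) choose (a - 1))) *\<^sub>Q zeta_m (N - r)"
  proof (cases "a \<le> r")
    case True
    have "take r (drop 1 w) = replicate (a - 1) False @ True # replicate (r - a) False"
      using rN r0 True assms by (intro nth_equalityI) (auto simp: len nth_w nth_Cons' nth_append)
    moreover have "s ! 1 = True" "s ! (1 + r + 1) = False"
      using s1[of 1] s2[of 1] rN True by auto
    moreover have "take 1 w @ drop (1 + r) w = True # replicate (N - r - 1) False"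
      using rN r0 True assms by (intro nth_equalityI) (auto simp: len nth_w nth_Cons' nth_append)
    moreover have "I_mot True (replicate (a - 1) False @ True # replicate (r - a) False) False =
        - (((-1) ^ a * of_nat ((r - 1) choose (a - 1))) *\<^sub>Q zeta_m r)"
    proof -
      have c: "(-1 :: rat) ^ r * (-1) ^ (r - a) = (-1) ^ a"
        using True by (auto simp: power_add[symmetric] minus_one_power_iff)
      have "r - 1 choose (r - a) = (r - 1 choose (a - 1))"
        using True assms binomial_symmetric[of "a - 1" "r - 1"] by simp
      then have "I_mot False (replicate (r - a) False @ True # replicate (a - 1) False) True =
          - (((-1) ^ (r - a) * of_nat ((r - 1) choose (a - 1))) *\<^sub>Q zeta_m r)"
        using True assms by (simp add: I_mot_single_True)
      then show ?thesis
        using True assms c by (simp add: I_mot_reverse mult.assoc[symmetric])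
    qed
    ultimately have "T 1 = l (- (((-1) ^ a * of_nat ((r - 1) choose (a - 1))) *\<^sub>Q zeta_m r)) *\<^sub>Q (- zeta_m (N - r))"
      unfolding T_def by (simp only: quot)
    then show ?thesis by (simp add: l_simps l_zeta)
  next
    case False
    have "T 1 = 0"
    proof (cases "r + 1 = a")
      case True
      then show ?thesis using s1[of 1] s2[of 1] rN by (intro loop) auto
    next
      case nsuc: False
      then show ?thesis using False rN by (intro T_zeros) auto
    qed
    moreover have "r - 1 < a - 1" using False r0 by linarith
    ultimately show ?thesis by simp
  qed
  \<comment> \<open>No reversal here: the sign is (-1)^(r-b), which is -(-1)^b because r is
    odd.\<close>
  have TN: "T (N - r) = (- ((-1) ^ b * of_nat ((r - 1) choose (b - 1)))) *\<^sub>Q zeta_m (N - r)"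
  proof (cases "b \<le> r")
    case True
    have "take r (drop (N - r) w) = replicate (r - b) False @ True # replicate (b - 1) False"
      using rN r0 True assms
      by (intro nth_equalityI) (auto simp: len nth_w nth_Cons' nth_append N_def)
    moreover have "s ! (N - r) = False" "s ! (N - r + r + 1) = True"
      using s1[of "N - r"] s2[of "N - r"] rN True by (auto simp: N_def)
    moreover have "take (N - r) w @ drop (N - r + r) w = True # replicate (N - r - 1) False"
      using rN r0 True assms
      by (intro nth_equalityI) (auto simp: len nth_w nth_Cons' nth_append N_def)
    moreover have "I_mot False (replicate (r - b) False @ True # replicate (b - 1) False) True =
        - ((- ((-1) ^ b) * of_nat ((r - 1) choose (b - 1))) *\<^sub>Q zeta_m r)"
    proof -
      have c: "(-1 :: rat) ^ (r - b) = - ((-1) ^ b)"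
        using True assms(3) by (auto simp: minus_one_power_iff)
      have "r - 1 choose (r - b) = (r - 1 choose (b - 1))"
        using True assms binomial_symmetric[of "b - 1" "r - 1"] by simp
      then show ?thesis
        using True assms c by (simp add: I_mot_single_True)
    qed
    ultimately have "T (N - r) = l (- ((- ((-1) ^ b) * of_nat ((r - 1) choose (b - 1))) *\<^sub>Q zeta_m r)) *\<^sub>Q (- zeta_m (N - r))"
      unfolding T_def by (simp only: quot)
    then show ?thesis by (simp add: l_simps l_zeta)
  next
    case False
    have "T (N - r) = 0"
    proof (cases "N - r = a + 1")
      case True
      then show ?thesis using s1[of "N - r"] s2[of "N - r"] rN by (intro loop) auto
    next
      case nsuc: False
      then show ?thesis using False rN by (intro T_zeros) (auto simp: N_def)
    qed
    moreover have "r - 1 < b - 1" using False r0 by linarith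
    ultimately show ?thesis by simp
  qed
  \<comment> \<open>Elsewhere the two endpoints agree or the subword consists of zeros.\<close>
  have T_other: "T p = 0" if "p \<notin> {0, 1, N - r}" "p \<le> N - r" for p
  proof (cases "p + r = a \<or> p = a + 1")
    case True
    then show ?thesis using that rN by (intro T_zeros) auto
  next
    case False
    then have "s ! p = s ! (p + r + 1)" using that rN s1[of p] s2[of p] by auto
    then show ?thesis using that rN by (intro loop) auto
  qed
  have "D_contract l r False w True = (\<Sum>p = 0..N - r. T p)"
    by (simp add: D_contract_def s_def T_def len Let_def)
  also have "\<dots> = (\<Sum>p\<in>{0, 1, N - r}. T p)"
    using rN by (intro sum.mono_neutral_right) (auto intro!: T_other)
  \<comment> \<open>\<open>N - r\<close> is at least 2, so the three positions are distinct.\<close>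
  also have "\<dots> = T 0 + T 1 + T (N - r)"
    using rN by simp
  also have "\<dots> = zeta2_coeff a b r *\<^sub>Q zeta_m (N - r)"
    unfolding T0 T1 TN zeta2_coeff_def
    by (simp only: scaleQ_add_left[symmetric] diff_conv_add_uminus)
  finally show ?thesis
    by (simp add: l_def w_def N_def)
qed

end

section \<open>The unipotent action in the f-alphabet\<close>

text \<open>The indices r for which the compatibility in \<open>normalized_iso\<close> applies in
  degree \<open>N\<close>.\<close>

definition odd_range :: "nat \<Rightarrow> nat set" where
  "odd_range N = {r. odd r \<and> 3 \<le> r \<and> r + 2 \<le> N}"

lemma finite_odd_range: "finite (odd_range N)"
  by (rule finite_subset[of _ "{..N}"]) (auto simp: odd_range_def)

lemma odd_rangeD:
  "r \<in> odd_range N \<Longrightarrow> odd r" "r \<in> odd_range N \<Longrightarrow> 3 \<le> r" "r \<in> odd_range N \<Longrightarrow> r + 2 \<le> N"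
  by (auto simp: odd_range_def)

lemma letter_eq_iff: "odd r \<Longrightarrow> 3 \<le> r \<Longrightarrow> letter r = k \<longleftrightarrow> r = 2 * k + 3"
  unfolding letter_def by presburger

lemma letter_inj: "odd r \<Longrightarrow> 3 \<le> r \<Longrightarrow> odd s \<Longrightarrow> 3 \<le> s \<Longrightarrow> letter r = letter s \<longleftrightarrow> r = s"
  by (metis letter_eq_iff)

lemma prefix_letter_0: "prefix_letter a 0 = 0"
  by (rule shuf_eqI) (auto simp: prefix_letter.rep_eq split: list.split)

lemma wcoeff_prefix_letter:
  "wcoeff (prefix_letter a x) [] = 0"
  "wcoeff (prefix_letter a x) (b # w) = (if b = a then wcoeff x w else 0)"
  by (simp_all add: prefix_letter.rep_eq)

text \<open>A right inverse of \<open>del_f r\<close>; \<open>prepend r (del_f r u)\<close> is the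
  part of \<open>u\<close> on words with first letter f_r.\<close>

definition prepend :: "nat \<Rightarrow> f_alphabet \<Rightarrow> f_alphabet" where
  "prepend r = map_poly (prefix_letter (letter r))"

lemma coeff_prepend: "coeff (prepend r u) i = prefix_letter (letter r) (coeff u i)"
  by (simp add: prepend_def coeff_map_poly prefix_letter_0)

lemma prepend_scaleQ: "prepend r (c *\<^sub>Q u) = c *\<^sub>Q prepend r u"
  by (rule poly_eqI) (simp add: coeff_prepend prefix_letter_scaleQ)

lemma prepend_monom: "prepend r (monom x k) = monom (prefix_letter (letter r) x) k"
  by (rule poly_eqI) (simp add: coeff_prepend prefix_letter_0)

lemma wcoeff_del_f: "wcoeff (coeff (del_f r u) i) ks = wcoeff (coeff u i) (letter r # ks)"
proof -
  define D where "D = lin (\<lambda>ks. case ks of [] \<Rightarrow> 0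
     | k # ks' \<Rightarrow> if k = letter r then word ks' else 0)"
  have "wcoeff (D x) ks = wcoeff x (letter r # ks)" for x
    by (rule shuf_linear_eqI[of "\<lambda>x. wcoeff (D x) ks"])
      (auto simp: D_def lin_add lin_scaleQ lin_word scaleQ_rat_def split: list.split)
  moreover have "coeff (del_f r u) i = D (coeff u i)"
    by (simp add: del_f_def D_def coeff_map_poly lin_zero)
  ultimately show ?thesis by simp
qed

lemma del_f_uminus: "del_f r (- u) = - del_f r u"
  by (intro poly_eqI shuf_eqI) (simp add: wcoeff_del_f)

lemma prefix_letter_1: "prefix_letter a 1 = word [a]"
  by (simp add: word_Nil[symmetric] prefix_letter_word)

lemma monom_scaleQ: "monom (c *\<^sub>Q x) k = c *\<^sub>Q monom x k"
  by (rule poly_eqI) simp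

lemma f_two_power: "f_two ^ k = monom 1 k"
proof (induction k)
  case (Suc k)
  have "f_two * monom 1 k = monom 1 (Suc k)"
    by (simp add: f_two_def monom_Suc)
  then show ?case by (simp add: Suc)
qed simp

lemma f_odd_monom: "f_odd r = monom (word [letter r]) 0"
  by (simp add: f_odd_def monom_0)

text \<open>The last summand is the part that no \<open>D\<^sub>r\<close> with \<open>r \<le> N - 2\<close> can see.\<close>

lemma U_deg_decomposition:
  assumes "u \<in> U_deg N" "2 \<le> N"
  shows "u = (\<Sum>r\<in>odd_range N. prepend r (del_f r u)) +
    (if even N then wcoeff (coeff u (N div 2)) [] *\<^sub>Q f_two ^ (N div 2) else c_f N u *\<^sub>Q f_odd N)"
    (is "u = ?S + ?tail")
proof (intro poly_eqI shuf_eqI)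
  fix i ks
  have deg: "wcoeff (coeff u i) ks \<noteq> 0 \<Longrightarrow> wt ks + 2 * i = N"
    using assms(1) by (auto simp: U_deg_def)
  show "wcoeff (coeff u i) ks = wcoeff (coeff (?S + ?tail) i) ks"
  proof (cases ks)
    case Nil
    have "wcoeff (coeff ?S i) ks = 0"
      by (simp add: Nil coeff_sum wcoeff_sum coeff_prepend wcoeff_prefix_letter)
    moreover have "wcoeff (coeff ?tail i) ks = wcoeff (coeff u i) ks"
      using deg by (cases "wcoeff (coeff u i) ks = 0") (auto simp: Nil f_two_power f_odd_monom wt_def)
    ultimately show ?thesis by simp
  next
    case (Cons k ks')
    have "wcoeff (coeff ?S i) ks = (\<Sum>r\<in>odd_range N. if r = 2 * k + 3 then wcoeff (coeff u i) ks else 0)"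
      unfolding coeff_sum wcoeff_sum
      by (intro sum.cong refl)
        (auto simp: Cons coeff_prepend wcoeff_prefix_letter wcoeff_del_f letter_def odd_range_def elim!: oddE)
    also have "\<dots> = (if 2 * k + 3 \<in> odd_range N then wcoeff (coeff u i) ks else 0)"
      by (simp add: finite_odd_range)
    finally have S: "wcoeff (coeff ?S i) ks = (if 2 * k + 3 \<in> odd_range N then wcoeff (coeff u i) ks else 0)" .
    have tail: "wcoeff (coeff ?tail i) ks =
        (if odd N \<and> i = 0 \<and> ks = [letter N] then wcoeff (coeff u i) ks else 0)"
      by (auto simp: Cons f_two_power f_odd_monom c_f_def)
    have N: "letter N = k \<longleftrightarrow> N = 2 * k + 3" if "odd N"
      using that assms(2) by (intro letter_eq_iff) presburger+
    show ?thesis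
    proof (cases "2 * k + 3 \<in> odd_range N")
      case True
      then have "(odd N \<and> i = 0 \<and> ks = [letter N]) = False"
        using N by (auto simp: Cons odd_range_def)
      then show ?thesis using True S tail by (simp only: coeff_add wcoeff_simps if_True if_False)
    next
      case False
      \<comment> \<open>If the first letter is outside \<open>odd_range N\<close>, what follows it
        has weight below 2, and there is nothing of weight 1: the word is the single letter
        f_N.\<close>
      have "odd N \<and> i = 0 \<and> ks = [letter N]" if nz: "wcoeff (coeff u i) ks \<noteq> 0"
      proof -
        have "2 * k + 3 + wt ks' + 2 * i = N"
          using deg[OF nz] by (simp add: Cons wt_def)
        moreover from this have "wt ks' + 2 * i < 2"
          using False by (auto simp: odd_range_def)
        moreover from this have "ks' = []" by (cases ks') (auto simp: wt_def)
        ultimately have "N = 2 * k + 3" "i = 0" "ks' = []" by (auto simp: wt_def)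
        then show ?thesis using N by (simp add: Cons)
      qed
      then show ?thesis using False S tail by (cases "wcoeff (coeff u i) ks = 0") auto
    qed
  qed
qed

section \<open>The torus and the unipotent group in coordinates\<close>

lemma wcoeff_lin_diagonal: "wcoeff (lin (\<lambda>ks. f ks *\<^sub>Q word ks) x) w = f w * wcoeff x w"
  by (rule shuf_linear_eqI[of "\<lambda>x. wcoeff (lin (\<lambda>ks. f ks *\<^sub>Q word ks) x) w"])
    (auto simp: lin_add lin_scaleQ lin_word scaleQ_rat_def algebra_simps)

lemma Gm_act_U_deg:
  assumes "u \<in> U_deg N" shows "Gm_act t u = t ^ N *\<^sub>Q u"
proof (intro poly_eqI shuf_eqI)
  fix j ks
  have "coeff (Gm_act t u) j = lin (\<lambda>ks. t ^ (wt ks + 2 * j) *\<^sub>Q word ks) (coeff u j)"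
    unfolding Gm_act_def coeff_sum by (auto simp: coeff_eq_0 lin_zero)
  moreover have "wt ks + 2 * j = N" if "wcoeff (coeff u j) ks \<noteq> 0"
    using assms that by (auto simp: U_deg_def)
  ultimately show "wcoeff (coeff (Gm_act t u) j) ks = wcoeff (coeff (t ^ N *\<^sub>Q u) j) ks"
    by (auto simp: wcoeff_lin_diagonal)
qed

lemma unip_act_right_translate: "unip_act g = map_poly (right_translate g)"
  by (simp add: unip_act_def right_translate_def)

lemma coeff_unip_act: "coeff (unip_act g u) i = right_translate g (coeff u i)"
  by (simp add: unip_act_right_translate coeff_map_poly right_translate_zero)

lemma unip_act_add: "unip_act g (u + v) = unip_act g u + unip_act g v"
  by (rule poly_eqI) (simp add: coeff_unip_act right_translate_add)

lemma unip_act_scaleQ: "unip_act g (c *\<^sub>Q u) = c *\<^sub>Q unip_act g u"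
  by (rule poly_eqI) (simp add: coeff_unip_act right_translate_scaleQ)

lemma unip_act_zero: "unip_act g 0 = 0"
  by (rule poly_eqI) (simp add: coeff_unip_act right_translate_zero)

lemma unip_act_sum: "unip_act g (sum f A) = (\<Sum>i\<in>A. unip_act g (f i))"
  by (induction A rule: infinite_finite_induct) (simp_all add: unip_act_zero unip_act_add)

lemma unip_act_monom: "unip_act g (monom x k) = monom (right_translate g x) k"
  by (rule poly_eqI) (simp add: coeff_unip_act right_translate_zero)

lemma right_translate_one: "rat_alg_hom g \<Longrightarrow> right_translate g 1 = 1"
  by (simp add: word_Nil[symmetric] right_translate_word)
    (simp add: word_Nil rat_alg_homD scaleQ_one)

lemma right_translate_word1:
  "rat_alg_hom g \<Longrightarrow> right_translate g (word [k]) = word [k] + g (word [k]) *\<^sub>Q 1"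
  by (simp add: right_translate_word word_Nil rat_alg_homD scaleQ_one)

lemma right_translate_word2:
  "rat_alg_hom g \<Longrightarrow> right_translate g (word [k, l]) =
     word [k, l] + g (word [l]) *\<^sub>Q word [k] + g (word [k, l]) *\<^sub>Q 1"
  by (simp add: right_translate_word word_Nil rat_alg_homD scaleQ_one numeral_2_eq_2)

lemma H_deg_I_mot: "I_mot x w y \<in> H_deg (length w)"
  unfolding H_deg_def by (rule ratv.span_base) auto

lemma zeta_m2_H_deg: "1 \<le> a \<Longrightarrow> 1 \<le> b \<Longrightarrow> zeta_m2 a b \<in> H_deg (a + b)"
  unfolding zeta_m2_def
  using H_deg_I_mot[of False "True # replicate (a - 1) False @ True # replicate (b - 1) False" True] by simp

lemma zeta_m_H_deg:
  assumes "1 \<le> n" shows "zeta_m n \<in> H_deg n"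
proof -
  have "- I_mot False (True # replicate (n - 1) False) True \<in> H_deg n"
    unfolding H_deg_def using H_deg_I_mot[of False "True # replicate (n - 1) False" True] assms
    by (intro ratv.span_neg) (simp add: H_deg_def)
  then show ?thesis by (simp add: zeta_m_def)
qed

lemma one_H_deg: "1 \<in> H_deg 0"
  using H_deg_I_mot[of False "[]" True] by (simp add: I_mot_Nil)

lemma H_deg_scale: "x \<in> H_deg n \<Longrightarrow> c *\<^sub>Q x \<in> H_deg n"
  and H_deg_diff: "x \<in> H_deg n \<Longrightarrow> y \<in> H_deg n \<Longrightarrow> x - y \<in> H_deg n"
  and H_deg_zero: "0 \<in> H_deg n"
  unfolding H_deg_def by (auto intro: ratv.span_scale ratv.span_diff ratv.span_zero)

lemma exp_char_U_dR: "exp_char k t \<in> U_dR"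
  by (simp add: U_dR_def rat_alg_hom_exp_char)

lemma V_mot_subspace:
  "x \<in> V_mot \<phi> a b \<Longrightarrow> y \<in> V_mot \<phi> a b \<Longrightarrow> x - y \<in> V_mot \<phi> a b"
  "x \<in> V_mot \<phi> a b \<Longrightarrow> c *\<^sub>Q x \<in> V_mot \<phi> a b"
  "(\<And>i. i \<in> A \<Longrightarrow> f i \<in> V_mot \<phi> a b) \<Longrightarrow> sum f A \<in> V_mot \<phi> a b"
  unfolding V_mot_def by (auto intro: ratv.span_diff ratv.span_scale ratv.span_sum)

lemma V_mot_cancel:
  assumes "c *\<^sub>Q x \<in> V_mot \<phi> a b" "c \<noteq> 0" shows "x \<in> V_mot \<phi> a b"
  using V_mot_subspace(2)[OF assms(1), of "inverse c"] assms(2) by (simp add: scaleQ_one)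

lemma span_image_coords:
  assumes "finite A" "v \<in> spanQ (e ` A)"
  shows "\<exists>c. v = (\<Sum>i\<in>A. c i *\<^sub>Q (e i :: 'b::rat_vector))"
  using assms(2)
proof (induction v rule: ratv.span_induct_alt)
  case base
  show ?case by (rule exI[of _ "\<lambda>_. 0"]) simp
next
  case (step k x y)
  then obtain c j where c: "y = (\<Sum>i\<in>A. c i *\<^sub>Q e i)" and j: "j \<in> A" "x = e j" by auto
  have "k *\<^sub>Q x = (\<Sum>i\<in>A. (if i = j then k else 0) *\<^sub>Q e i)"
    using assms(1) j by (subst sum.remove[of _ j]) (auto intro!: sum.neutral)
  then have "k *\<^sub>Q x + y = (\<Sum>i\<in>A. ((if i = j then k else 0) + c i) *\<^sub>Q e i)"
    by (simp add: c scaleQ_add_left sum.distrib)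
  then show ?case by (intro exI[of _ "\<lambda>i. (if i = j then k else 0) + c i"])
qed

lemma span_coefficient: "(c \<noteq> 0 \<Longrightarrow> x \<in> S) \<Longrightarrow> (c * d) *\<^sub>Q x \<in> spanQ S"
  by (cases "c = 0") (simp_all add: ratv.span_zero ratv.span_scale[OF ratv.span_base])

section \<open>The orbit of zeta(a,b)\<close>

context normalized
begin

definition act :: "(nat shuf \<Rightarrow> rat) \<Rightarrow> mmzv \<Rightarrow> mmzv" where
  "act g x = inv \<phi> (unip_act g (\<phi> x))"

text \<open>The double zeta value is homogeneous, so the torus only rescales it and does not change
  the span.\<close>

lemma V_mot_eq:
  assumes "1 \<le> a" "1 \<le> b"
  shows "V_mot \<phi> a b = spanQ ((\<lambda>g. act g (zeta_m2 a b)) ` U_dR)"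
proof -
  let ?z = "zeta_m2 a b"
  have orbit: "inv \<phi> (unip_act g (Gm_act t (\<phi> ?z))) = t ^ (a + b) *\<^sub>Q act g ?z" for g t
  proof -
    have "Gm_act t (\<phi> ?z) = t ^ (a + b) *\<^sub>Q \<phi> ?z"
      using zeta_m2_H_deg[OF assms] by (intro Gm_act_U_deg) (simp add: H_deg_iff)
    then show ?thesis
      by (simp add: act_def unip_act_scaleQ phi_simps inv_phi_eqI)
  qed
  have "act g ?z \<in> G_orbit \<phi> ?z" if "g \<in> U_dR" for g
    unfolding G_orbit_def orbit using that by (intro CollectI exI[of _ g] exI[of _ 1]) (simp add: scaleQ_one)
  then have 1: "(\<lambda>g. act g ?z) ` U_dR \<subseteq> spanQ (G_orbit \<phi> ?z)"
    by (auto intro: ratv.span_base)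
  have 2: "G_orbit \<phi> ?z \<subseteq> spanQ ((\<lambda>g. act g ?z) ` U_dR)"
    unfolding G_orbit_def orbit by (blast intro: ratv.span_scale ratv.span_base)
  show ?thesis
    unfolding V_mot_def using 1 2 by (simp add: ratv.span_eq)
qed

text \<open>All derivations vanish by \<open>D_zeta_m\<close>, so only the last summand of
  \<open>U_deg_decomposition\<close> is left.\<close>

lemma zeta_m_even:
  assumes "even n" "2 \<le> n"
  shows "\<exists>q. \<phi> (zeta_m n) = q *\<^sub>Q f_two ^ (n div 2)"
proof -
  have "del_f r (\<phi> (zeta_m n)) = 0" if r: "r \<in> odd_range n" for r
  proof -
    have "del_f r (\<phi> (I_mot False (True # replicate (n - 1) False) True)) = 0"
      using odd_rangeD[OF r] D_zeta_m[of r n] del_f_phi[of r "True # replicate (n - 1) False" False True]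
      by (simp add: phi_simps)
    then show ?thesis by (simp add: zeta_m_def phi_simps del_f_uminus)
  qed
  moreover have "\<phi> (zeta_m n) \<in> U_deg n"
    using zeta_m_H_deg[of n] assms by (simp add: H_deg_iff)
  ultimately show ?thesis
    using U_deg_decomposition[of "\<phi> (zeta_m n)" n] assms
    by (auto simp: prepend_def)
qed

definition zeta2_tail :: "nat \<Rightarrow> nat \<Rightarrow> f_alphabet" where
  "zeta2_tail a b = (if even (a + b)
     then wcoeff (coeff (\<phi> (zeta_m2 a b)) ((a + b) div 2)) [] *\<^sub>Q f_two ^ ((a + b) div 2)
     else c_f (a + b) (\<phi> (zeta_m2 a b)) *\<^sub>Q f_odd (a + b))"

lemma phi_zeta_m2:
  assumes "1 \<le> a" "2 \<le> b"
  shows "\<phi> (zeta_m2 a b) = (\<Sum>r\<in>odd_range (a + b).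
     zeta2_coeff a b r *\<^sub>Q prepend r (\<phi> (zeta_m (a + b - r)))) + zeta2_tail a b"
proof -
  have "del_f r (\<phi> (zeta_m2 a b)) = zeta2_coeff a b r *\<^sub>Q \<phi> (zeta_m (a + b - r))" if "r \<in> odd_range (a + b)" for r
    using odd_rangeD[OF that] assms D_zeta_m2[of a b r]
      del_f_phi[of r "True # replicate (a - 1) False @ True # replicate (b - 1) False" False True]
    by (simp add: zeta_m2_def phi_simps)
  then have "(\<Sum>r\<in>odd_range (a + b). prepend r (del_f r (\<phi> (zeta_m2 a b)))) =
      (\<Sum>r\<in>odd_range (a + b). zeta2_coeff a b r *\<^sub>Q prepend r (\<phi> (zeta_m (a + b - r))))"
    by (intro sum.cong) (simp_all add: prepend_scaleQ)
  moreover have "\<phi> (zeta_m2 a b) \<in> U_deg (a + b)"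
    using zeta_m2_H_deg[of a b] assms by (simp add: H_deg_iff)
  ultimately show ?thesis
    using U_deg_decomposition[of "\<phi> (zeta_m2 a b)" "a + b"] assms
    by (simp add: zeta2_tail_def)
qed

text \<open>Deconcatenation of f_r f_{N-r} leaves the word, f_r with coefficient g(f_{N-r}), and a
  constant; the power of f_2 is fixed.\<close>

lemma act_zeta_m2_even:
  assumes "1 \<le> a" "2 \<le> b" "even (a + b)" "rat_alg_hom g"
  shows "act g (zeta_m2 a b) = zeta_m2 a b +
    (\<Sum>r\<in>odd_range (a + b). (zeta2_coeff a b r * g (word [letter (a + b - r)])) *\<^sub>Q zeta_m r) +
    (\<Sum>r\<in>odd_range (a + b). zeta2_coeff a b r * g (word [letter r, letter (a + b - r)])) *\<^sub>Q 1"
proof -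
  let ?N = "a + b" and ?c = "zeta2_coeff a b"
  have tail: "unip_act g (zeta2_tail a b) = zeta2_tail a b"
    using assms by (simp add: zeta2_tail_def unip_act_scaleQ f_two_power unip_act_monom right_translate_one)
  have "unip_act g (prepend r (\<phi> (zeta_m (?N - r)))) = prepend r (\<phi> (zeta_m (?N - r))) +
      g (word [letter (?N - r)]) *\<^sub>Q \<phi> (zeta_m r) + g (word [letter r, letter (?N - r)]) *\<^sub>Q 1"
    if "r \<in> odd_range ?N" for r
  proof -
    have "odd (?N - r)" "3 \<le> ?N - r" using odd_rangeD[OF that] assms(3) by presburger+
    then show ?thesis
      using odd_rangeD[OF that] assms(4)
      by (simp add: phi_zeta_odd f_odd_monom prepend_monom unip_act_monom prefix_letter_word
          right_translate_word2 add_monom[symmetric] monom_scaleQ)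
  qed
  then have "unip_act g (\<phi> (zeta_m2 a b)) = \<phi> (zeta_m2 a b) +
    (\<Sum>r\<in>odd_range ?N. (?c r * g (word [letter (?N - r)])) *\<^sub>Q \<phi> (zeta_m r)) +
    (\<Sum>r\<in>odd_range ?N. ?c r * g (word [letter r, letter (?N - r)])) *\<^sub>Q 1"
    unfolding phi_zeta_m2[OF assms(1,2)]
    by (simp add: unip_act_add unip_act_sum unip_act_scaleQ tail scaleQ_add_right sum.distrib
        ratv.scale_sum_left)
  then show ?thesis
    unfolding act_def by (intro inv_phi_eqI) (simp add: phi_simps phi_sum)
qed

text \<open>Now f_{N-r} is replaced by a multiple of a power of f_2, which is fixed; cutting off f_r
  leaves zeta(N-r), and the constant comes from f_N alone.\<close>

lemma act_zeta_m2_odd: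
  assumes "1 \<le> a" "2 \<le> b" "odd (a + b)" "rat_alg_hom g"
  shows "act g (zeta_m2 a b) = zeta_m2 a b +
    (\<Sum>r\<in>odd_range (a + b). (zeta2_coeff a b r * g (word [letter r])) *\<^sub>Q zeta_m (a + b - r)) +
    (c_f (a + b) (\<phi> (zeta_m2 a b)) * g (word [letter (a + b)])) *\<^sub>Q 1"
proof -
  let ?N = "a + b" and ?c = "zeta2_coeff a b"
  define C where "C = c_f ?N (\<phi> (zeta_m2 a b))"
  have tail: "unip_act g (zeta2_tail a b) = zeta2_tail a b +
      (C * g (word [letter (a + b)])) *\<^sub>Q 1"
    using assms by (simp add: zeta2_tail_def C_def[symmetric] unip_act_scaleQ f_odd_monom unip_act_monom
        right_translate_word1 add_monom[symmetric] monom_scaleQ scaleQ_add_right)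
  have "unip_act g (prepend r (\<phi> (zeta_m (?N - r)))) = prepend r (\<phi> (zeta_m (?N - r))) +
      g (word [letter r]) *\<^sub>Q \<phi> (zeta_m (?N - r))"
    if "r \<in> odd_range ?N" for r
  proof -
    have "even (?N - r)" "2 \<le> ?N - r" using odd_rangeD[OF that] assms(3) by presburger+
    then obtain q where "\<phi> (zeta_m (?N - r)) = q *\<^sub>Q f_two ^ ((?N - r) div 2)"
      using zeta_m_even by blast
    then show ?thesis
      using assms(4)
      by (simp add: f_two_power prepend_scaleQ prepend_monom unip_act_scaleQ unip_act_monom
          prefix_letter_1 right_translate_word1 add_monom[symmetric] monom_scaleQ
          scaleQ_add_right mult.commute)
  qed
  then have "unip_act g (\<phi> (zeta_m2 a b)) = \<phi> (zeta_m2 a b) +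
    (\<Sum>r\<in>odd_range ?N. (?c r * g (word [letter r])) *\<^sub>Q \<phi> (zeta_m (?N - r))) +
    (C * g (word [letter (a + b)])) *\<^sub>Q 1"
    unfolding phi_zeta_m2[OF assms(1,2)]
    by (simp add: unip_act_add unip_act_sum unip_act_scaleQ tail scaleQ_add_right sum.distrib)
  then show ?thesis
    unfolding act_def C_def[symmetric] by (intro inv_phi_eqI) (simp add: phi_simps phi_sum)
qed

end

section \<open>Periods in odd weight\<close>

lemma powr_summable_on_nat: "(\<lambda>n. real n powr (-3/2)) summable_on UNIV"
  by (subst summable_on_UNIV_nonneg_real_iff) (simp_all add: summable_real_powr_iff)

lemma powr_summable_on_pairs:
  "(\<lambda>(m, n). real m powr (-3/2) * real n powr (-3/2)) summable_on (UNIV \<times> UNIV)"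
proof (rule summable_on_SigmaI)
  let ?p = "\<lambda>n. real n powr (-3/2)"
  show "((\<lambda>n. case (m, n) of (m, n) \<Rightarrow> ?p m * ?p n) has_sum ?p m * infsum ?p UNIV) UNIV" for m
    using powr_summable_on_nat by (simp add: has_sum_cmult_right)
  show "(\<lambda>m. ?p m * infsum ?p UNIV) summable_on UNIV"
    using powr_summable_on_nat by (rule summable_on_cmult_left)
qed auto

text \<open>The worst case is a = 1, b = 2; since m < n, half a power of m may be traded for one of
  n, giving a summable product of two single series.\<close>

lemma double_zeta_term_le:
  fixes m n a b :: nat
  assumes "0 < m" "m < n" "1 \<le> a" "2 \<le> b"
  shows "1 / real m ^ a * (1 / real n ^ b) \<le> real m powr (-3/2) * real n powr (-3/2)"
proof -
  have "real m powr (3/2) = real m * real m powr (1/2)"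
    using assms by (simp add: powr_mult_base)
  also have "\<dots> \<le> real m * real n powr (1/2)"
    using assms by (intro mult_left_mono powr_mono2) auto
  finally have "real m powr (3/2) \<le> real m * real n powr (1/2)" .
  from mult_right_mono[OF this, of "real n powr (3/2)"]
  have "real m powr (3/2) * real n powr (3/2) \<le> real m * (real n powr (1/2) * real n powr (3/2))"
    by (simp add: mult.assoc)
  also have "real n powr (1/2) * real n powr (3/2) = real n ^ 2"
    using assms by (simp add: powr_add[symmetric] powr_numeral)
  also have "real m * real n ^ 2 \<le> real m ^ a * real n ^ b"
    using assms self_le_power[of "real m" a]
    by (intro mult_mono power_increasing) auto
  finally have "1 / (real m ^ a * real n ^ b) \<le> 1 / (real m powr (3/2) * real n powr (3/2))"
    using assms by (intro divide_left_mono) auto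
  then show ?thesis by (simp add: powr_minus_divide)
qed

lemma mzv_nonneg: "0 \<le> mzv ns"
  unfolding mzv_def by (intro infsum_nonneg prod_nonneg) auto

text \<open>\<open>infsum\<close> defaults to 0 on families that are not summable, so summability
  comes before the lower bound by the term at (1, 2).\<close>

lemma mzv_double_pos:
  assumes "1 \<le> a" "2 \<le> b" shows "0 < mzv [a, b]"
proof -
  let ?S = "{ks :: nat list. length ks = length [a, b] \<and> sorted_wrt (<) (0 # ks)}"
  let ?f = "\<lambda>ks :: nat list. \<Prod>i<length [a, b]. 1 / real (ks ! i) ^ ([a, b] ! i)"
  let ?T = "{(m :: nat, n :: nat). 0 < m \<and> m < n}"
  have S: "?S = (\<lambda>(m, n). [m, n]) ` ?T"
    by (auto simp: image_def length_Suc_conv numeral_2_eq_2) force?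
  have "(\<lambda>(m, n). 1 / real m ^ a * (1 / real n ^ b)) summable_on ?T"
  proof (rule summable_on_comparison_test)
    show "(\<lambda>(m, n). real m powr (-3/2) * real n powr (-3/2)) summable_on ?T"
      by (rule summable_on_subset_banach[OF powr_summable_on_pairs]) auto
  qed (use double_zeta_term_le assms in auto)
  also have "(\<lambda>(m, n). 1 / real m ^ a * (1 / real n ^ b)) = ?f \<circ> (\<lambda>(m, n). [m, n])"
    by (auto simp: fun_eq_iff numeral_2_eq_2 lessThan_Suc mult.commute)
  finally have "?f \<circ> (\<lambda>(m, n). [m, n]) summable_on ?T" .
  moreover have "inj_on (\<lambda>(m, n). [m, n]) ?T" by (auto simp: inj_on_def)
  ultimately have "?f summable_on ?S"
    unfolding S by (simp only: summable_on_reindex)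
  then have "sum ?f {[1, 2]} \<le> infsum ?f ?S"
    by (rule finite_sum_le_infsum) (auto intro!: prod_nonneg)
  moreover have "0 < sum ?f {[1, 2]}" by (auto intro!: prod_pos simp: less_Suc_eq)
  ultimately show ?thesis unfolding mzv_def by linarith
qed

text \<open>Words that start with 1 and end with 0 are fixed by both regularizations.\<close>

lemma per_word_admissible: "per (word (True # m @ [False])) = per_adm (True # m @ [False])"
  by (simp add: per_def lin_word reg_right_def reg_left_def word_Nil scaleQ_one)

lemma per_lin: "per x = lin (\<lambda>w. per (word w)) x"
  by (rule shuf_linear_eqI[of per]) (simp_all add: per_add per_scaleQ lin_add lin_scaleQ lin_word)

lemma length_exponents: "length (exponents w) = count (mset w) True"
  by (induction w) auto

lemma exponents_replicate_False [simp]: "exponents (replicate n False) = []"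
  by (induction n) auto

lemma exponents_append_False: "exponents (replicate n False @ w) = exponents w"
  by (induction n) auto

lemma takeWhile_False_True: "takeWhile Not (replicate n False @ True # w) = replicate n False"
  by (induction n) auto

lemma per_double_word:
  assumes "1 \<le> a" "2 \<le> b"
  shows "per (word (True # replicate (a - 1) False @ True # replicate (b - 1) False)) = mzv [a, b]"
proof -
  define m where "m = replicate (a - 1) False @ True # replicate (b - 2) False"
  have "replicate (b - 1) False = replicate (b - 2) False @ [False]"
    using assms by (simp add: replicate_append_same flip: replicate_Suc)
  then have w: "True # replicate (a - 1) False @ True # replicate (b - 1) False = True # m @ [False]"
    by (simp add: m_def)
  have "exponents (True # replicate (a - 1) False @ True # replicate (b - 1) False) = [a, b]"
    using assms by (simp add: exponents_append_False takeWhile_False_True)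
  then show ?thesis
    unfolding w per_word_admissible by (simp add: per_adm_def)
qed

section \<open>Lower bounds for periods of shuffle products\<close>

lemma shuffles_last:
  "w \<in> shuffles u v \<Longrightarrow> w \<noteq> [] \<Longrightarrow> (u \<noteq> [] \<and> last w = last u) \<or> (v \<noteq> [] \<and> last w = last v)"
proof (induction u v arbitrary: w rule: shuffles.induct)
  case (3 x xs y ys)
  then show ?case by (fastforce split: if_splits)
qed auto

lemma shuffle_coeff_nonneg: "0 \<le> wcoeff (word u * word v) w"
proof (induction u v arbitrary: w rule: shuffles.induct)
  case (3 x xs y ys)
  show ?case
    using "3.IH" by (cases w) (simp_all add: word_Cons_mult wcoeff_prefix_letter del: wcoeff_simps(8))
qed (simp_all add: word_Nil del: wcoeff_simps(8))

lemma shuffle_coeff_ge_1: "w \<in> shuffles u v \<Longrightarrow> 1 \<le> wcoeff (word u * word v) w"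
proof (induction u v arbitrary: w rule: shuffles.induct)
  case (3 x xs y ys)
  have n: "0 \<le> wcoeff (prefix_letter a (word u * word v)) w" for a u v
    using shuffle_coeff_nonneg[of u v] by (cases w) (simp_all add: wcoeff_prefix_letter del: wcoeff_simps(8))
  from "3.prems" consider w' where "w = x # w'" "w' \<in> shuffles xs (y # ys)"
    | w' where "w = y # w'" "w' \<in> shuffles (x # xs) ys"
    by auto
  then show ?case
  proof cases
    case 1
    then have "1 \<le> wcoeff (prefix_letter x (word xs * word (y # ys))) w"
      using "3.IH"(1) by (simp add: wcoeff_prefix_letter del: wcoeff_simps(8))
    then show ?thesis
      using n[of y "x # xs" ys] by (simp add: word_Cons_mult del: wcoeff_simps(8))
  next
    case 2
    then have "1 \<le> wcoeff (prefix_letter y (word (x # xs) * word ys)) w"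
      using "3.IH"(2) by (simp add: wcoeff_prefix_letter del: wcoeff_simps(8))
    then show ?thesis
      using n[of x xs "y # ys"] by (simp add: word_Cons_mult del: wcoeff_simps(8))
  qed
qed (simp_all add: word_Nil del: wcoeff_simps(8))

lemma shuffle_support: "w \<in> supp (word u * word v) \<Longrightarrow> w \<in> shuffles u v"
  using shuffle_mult_support[of "wcoeff (word u)" "wcoeff (word v)" w]
  by (auto simp: supp_def split: if_splits)

text \<open>Both factors start with 1 and end with 0, hence so does each shuffle; it contains two
  ones, so its sign is positive.\<close>

lemma shuffles_depth_1:
  assumes "w \<in> shuffles (True # replicate (Suc m) False) (True # replicate (Suc n) False)"
  shows "0 \<le> per (word w)"
proof -
  obtain w' where w: "w = True # w'" using assms by auto
  have "w' \<noteq> []" using length_shuffles[OF assms] w by auto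
  moreover have "last w = False" using shuffles_last[OF assms] w by (auto split: if_splits)
  ultimately have w2: "w = True # butlast w' @ [False]"
    using w append_butlast_last_id[of w'] by auto
  have "mset w = mset (True # replicate (Suc m) False) + mset (True # replicate (Suc n) False)"
    using assms by (rule mset_shuffles)
  then have "length (exponents w) = 2" by (simp add: length_exponents)
  then have "0 \<le> per_adm w" by (simp add: per_adm_def mzv_nonneg)
  then show ?thesis using w2 per_word_admissible by metis
qed

lemma per_shuffle_term_nonneg:
  assumes "w \<in> supp (word (True # replicate (Suc m) False) * word (True # replicate (Suc n) False))"
  shows "0 \<le> real_of_rat (wcoeff (word (True # replicate (Suc m) False) *
    word (True # replicate (Suc n) False)) w) * per (word w)"
  using shuffles_depth_1[OF shuffle_support[OF assms]] shuffle_coeff_nonneg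
  by (intro mult_nonneg_nonneg) (simp_all del: replicate_Suc wcoeff_simps(8))

text \<open>All terms of the product have nonnegative periods, and \<open>w\<close> has multiplicity
  at least 1.\<close>

lemma per_shuffle_ge:
  assumes "w \<in> shuffles (True # replicate (Suc m) False) (True # replicate (Suc n) False)"
  shows "per (word w) \<le> per (word (True # replicate (Suc m) False) * word (True # replicate (Suc n) False))"
    (is "_ \<le> per ?x")
proof -
  let ?g = "\<lambda>w. real_of_rat (wcoeff ?x w) * per (word w)"
  have c: "1 \<le> wcoeff ?x w" by (rule shuffle_coeff_ge_1[OF assms])
  then have "w \<in> supp ?x" by (auto simp: supp_def)
  have "per (word w) \<le> ?g w"
    using mult_right_mono[of 1 "real_of_rat (wcoeff ?x w)" "per (word w)"] c shuffles_depth_1[OF assms]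
    by simp
  also have "\<dots> \<le> (\<Sum>v\<in>supp ?x. ?g v)"
    using \<open>w \<in> supp ?x\<close> per_shuffle_term_nonneg by (intro member_le_sum) (auto simp: finite_supp)
  also have "\<dots> = per ?x"
    by (subst per_lin) (simp add: lin_def scaleQ_real_def)
  finally show ?thesis .
qed

lemma per_shuffle_nonneg:
  "0 \<le> per (word (True # replicate (Suc m) False) * word (True # replicate (Suc n) False))" (is "_ \<le> per ?x")
proof -
  have "0 \<le> (\<Sum>v\<in>supp ?x. wcoeff ?x v *\<^sub>Q per (word v))"
    unfolding scaleQ_real_def by (intro sum_nonneg per_shuffle_term_nonneg)
  then show ?thesis by (subst per_lin) (simp add: lin_def)
qed

lemma shuffles_replicate_left:
  "w \<in> shuffles u v \<Longrightarrow> replicate n x @ w \<in> shuffles (replicate n x @ u) v"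
  by (induction n) (auto intro: Cons_in_shuffles_leftI)

text \<open>Insert the word 1 0 of zeta(2), as a block, after the a-th letter of the word of
  zeta(N-2).\<close>

lemma double_word_in_shuffles:
  assumes "1 \<le> a" "2 \<le> b"
  shows "True # replicate (a - 1) False @ True # replicate (b - 1) False \<in>
    shuffles (True # replicate (a + b - 3) False) [True, False]"
proof -
  have "replicate (b - 2) False \<in> shuffles (replicate (b - 2) False) []" by simp
  then have "True # False # replicate (b - 2) False \<in> shuffles (replicate (b - 2) False) [True, False]"
    by (intro Cons_in_shuffles_rightI)
  then have "True # replicate (a - 1) False @ True # False # replicate (b - 2) False \<in>
      shuffles (True # replicate (a - 1) False @ replicate (b - 2) False) [True, False]"
    by (intro Cons_in_shuffles_leftI shuffles_replicate_left)
  moreover have "replicate (b - 1) False = False # replicate (b - 2) False"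
    using assms by (simp flip: replicate_Suc)
  moreover have "replicate (a - 1) False @ replicate (b - 2) False = replicate (a + b - 3) False"
    using assms by (simp add: replicate_add[symmetric])
  ultimately show ?thesis by (simp only:)
qed

lemma zeta_m_abs: "zeta_m n = - abs_mmzv (word (True # replicate (n - 1) False))"
  by (simp add: zeta_m_def I_mot_word)

lemma abs_mmzv_sum: "abs_mmzv (sum f A) = (\<Sum>i\<in>A. abs_mmzv (f i))"
  by (induction A rule: infinite_finite_induct) (simp_all add: abs_mmzv_add zero_mmzv.abs_eq)

lemma per_sum: "per (sum f A) = (\<Sum>i\<in>A. per (f i))"
  by (induction A rule: infinite_finite_induct) (simp_all add: per_zero per_add)

section \<open>The coefficient of f_N in odd weight\<close>

context normalized
begin

text \<open>The even zeta value is a multiple of a power of f_2, so prefixing f_r to it is the same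
  as multiplying by f_r.\<close>

lemma zeta_m2_odd_weight:
  assumes "1 \<le> a" "2 \<le> b" "odd (a + b)"
  shows "zeta_m2 a b = (\<Sum>r\<in>odd_range (a + b). zeta2_coeff a b r *\<^sub>Q (zeta_m r * zeta_m (a + b - r))) +
    c_f (a + b) (\<phi> (zeta_m2 a b)) *\<^sub>Q zeta_m (a + b)"
proof -
  let ?N = "a + b" and ?c = "zeta2_coeff a b"
  define C where "C = c_f ?N (\<phi> (zeta_m2 a b))"
  have "prepend r (\<phi> (zeta_m (?N - r))) = \<phi> (zeta_m r * zeta_m (?N - r))" if "r \<in> odd_range ?N" for r
  proof -
    have "even (?N - r)" "2 \<le> ?N - r" using odd_rangeD[OF that] assms(3) by presburger+
    then obtain q where "\<phi> (zeta_m (?N - r)) = q *\<^sub>Q f_two ^ ((?N - r) div 2)"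
      using zeta_m_even by blast
    then show ?thesis
      using odd_rangeD[OF that]
      by (simp add: phi_simps phi_zeta_odd f_two_power f_odd_monom prepend_scaleQ prepend_monom
          prefix_letter_1 mult_monom mult_scaleQ_left mult.commute[of "monom _ 0"] )
  qed
  moreover have "zeta2_tail a b = \<phi> (C *\<^sub>Q zeta_m ?N)"
    using assms by (simp add: zeta2_tail_def C_def phi_simps phi_zeta_odd)
  ultimately have "\<phi> (zeta_m2 a b) =
      \<phi> ((\<Sum>r\<in>odd_range ?N. ?c r *\<^sub>Q (zeta_m r * zeta_m (?N - r))) + C *\<^sub>Q zeta_m ?N)"
    unfolding phi_zeta_m2[OF assms(1,2)] by (simp add: phi_simps(1,2) phi_sum)
  then show ?thesis
    using inj_phi by (simp add: inj_eq C_def)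
qed

text \<open>The coefficient of \<open>f\<^sub>N\<close> is invisible to the derivations \<open>D\<^sub>r\<close>. If it vanished, the period
  \<open>\<zeta>(a,b)\<close> would be a combination of the products \<open>\<zeta>(r) \<zeta>(N-r)\<close> with coefficients of constant sign
  \<open>(-1)\<^sup>a\<close>; by the shuffle product these are sums of double zeta values, and for even \<open>a\<close> the term
  \<open>r = N - 2\<close> alone exceeds \<open>\<zeta>(a,b)\<close>.\<close>

lemma c_f_zeta_m2_nonzero:
  assumes "1 \<le> a" "2 \<le> b" "odd (a + b)"
  shows "c_f (a + b) (\<phi> (zeta_m2 a b)) \<noteq> 0"
proof
  let ?N = "a + b" and ?c = "zeta2_coeff a b"
  let ?u = "\<lambda>n. word (True # replicate (n - 1) False)"
  let ?w = "True # replicate (a - 1) False @ True # replicate (b - 1) False"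
  let ?P = "\<lambda>r. per (?u r * ?u (?N - r))"
  let ?M = "per (word ?w)"
  assume "c_f ?N (\<phi> (zeta_m2 a b)) = 0"
  then have "zeta_m2 a b = (\<Sum>r\<in>odd_range ?N. ?c r *\<^sub>Q (zeta_m r * zeta_m (?N - r)))"
    using zeta_m2_odd_weight[OF assms] by simp
  then have "abs_mmzv (word ?w) = abs_mmzv (\<Sum>r\<in>odd_range ?N. ?c r *\<^sub>Q (?u r * ?u (?N - r)))"
    unfolding abs_mmzv_sum abs_mmzv_scaleQ abs_mmzv_mult zeta_m_abs
    by (simp add: zeta_m2_def I_mot_word)
  then have "word ?w - (\<Sum>r\<in>odd_range ?N. ?c r *\<^sub>Q (?u r * ?u (?N - r))) \<in> J_MT"
    by (simp only: mmzv.abs_eq_iff)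
  then have "per (word ?w - (\<Sum>r\<in>odd_range ?N. ?c r *\<^sub>Q (?u r * ?u (?N - r)))) = 0"
    by (rule J_MT_per)
  then have M: "?M = (\<Sum>r\<in>odd_range ?N. real_of_rat (?c r) * ?P r)"
    using per_add[of "word ?w - (\<Sum>r\<in>odd_range ?N. ?c r *\<^sub>Q (?u r * ?u (?N - r)))"
        "\<Sum>r\<in>odd_range ?N. ?c r *\<^sub>Q (?u r * ?u (?N - r))"]
    by (simp add: per_sum per_scaleQ scaleQ_real_def)
  have M_pos: "0 < ?M"
    using assms by (simp only: per_double_word mzv_double_pos)
  have u: "\<exists>m n. ?u r = word (True # replicate (Suc m) False) \<and> ?u (?N - r) = word (True # replicate (Suc n) False)"
    if "r \<in> odd_range ?N" for r
  proof -
    have "r - 1 = Suc (r - 2)" "?N - r - 1 = Suc (?N - r - 2)"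
      using odd_rangeD[OF that] by linarith+
    then show ?thesis by metis
  qed
  have P: "0 \<le> ?P r" if "r \<in> odd_range ?N" for r
    using u[OF that] per_shuffle_nonneg by metis
  show False
  proof (cases "odd a")
    case True
    then have "real_of_rat (?c r) * ?P r \<le> 0" if "r \<in> odd_range ?N" for r
    proof -
      have "even b" using True assms(3) by simp
      then have "?c r \<le> 0"
        using True by (auto simp: zeta2_coeff_def)
      then show ?thesis using P[OF that] by (simp add: mult_nonpos_nonneg)
    qed
    then have "?M \<le> 0" unfolding M by (rule sum_nonpos)
    then show False using M_pos by simp
  next
    case False
    then have ab: "2 \<le> a" "odd b" "3 \<le> b" using assms by presburger+
    have c: "?c r = of_nat ((r - 1) choose (a - 1)) + of_nat ((r - 1) choose (b - 1))"
      if "r \<in> odd_range ?N" for r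
      using odd_rangeD[OF that] False ab by (auto simp: zeta2_coeff_def)
    have N2: "?N - 2 \<in> odd_range ?N" using ab assms(3) by (auto simp: odd_range_def)
    \<comment> \<open>Both binomial coefficients are positive at r = N - 2, so this term alone is at
      least twice the positive period it should be bounded by.\<close>
    have "1 \<le> (?N - 2 - 1) choose (a - 1)" "1 \<le> (?N - 2 - 1) choose (b - 1)"
      using ab by (auto simp: Suc_le_eq zero_less_binomial_iff)
    then have "2 \<le> ((?N - 2 - 1) choose (a - 1)) + ((?N - 2 - 1) choose (b - 1))"
      by linarith
    then have "(2 :: rat) \<le> of_nat (((?N - 2 - 1) choose (a - 1)) + ((?N - 2 - 1) choose (b - 1)))"
      by (metis of_nat_le_iff of_nat_numeral)
    then have "2 \<le> ?c (?N - 2)" using c[OF N2] by simp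
    then have c2: "2 \<le> real_of_rat (?c (?N - 2))"
      by (metis of_rat_less_eq of_rat_numeral_eq)
    have "?M \<le> ?P (?N - 2)"
    proof -
      have e: "?N - 2 - 1 = Suc (?N - 4)" "?N - 3 = Suc (?N - 4)" "?N - (?N - 2) - 1 = Suc 0"
        using ab by linarith+
      show ?thesis
        using double_word_in_shuffles[OF assms(1,2)] per_shuffle_ge[of ?w "?N - 4" 0]
        unfolding e by simp
    qed
    then have "2 * ?M \<le> real_of_rat (?c (?N - 2)) * ?P (?N - 2)"
      by (intro mult_mono) (use c2 M_pos in linarith)+
    also have "\<dots> \<le> ?M"
      unfolding M using P N2 c by (intro member_le_sum) (auto simp: finite_odd_range)
    finally show False using M_pos by simp
  qed
qed

end

section \<open>The span of the orbit\<close>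

text \<open>Row n takes a nonzero value twice only at k and n - k; \<open>n < k + l\<close> excludes
  this symmetry, and the last assumption excludes that both entries are 0.\<close>

lemma binomial_distinct:
  fixes k l n :: nat
  assumes "k \<noteq> l" "n < k + l" "k \<le> n \<or> l \<le> n"
  shows "n choose k \<noteq> n choose l"
proof -
  have less: "n choose l < n choose k" if "k < l" "n < k + l" "k \<le> n" for k l :: nat
  proof (cases "l \<le> n")
    case False
    then show ?thesis using that by (simp add: binomial_eq_0)
  next
    case True
    show ?thesis
    proof (cases "n \<le> 2 * k")
      case True
      then show ?thesis using that \<open>l \<le> n\<close> by (intro binomial_strict_antimono) auto
    next
      case False
      \<comment> \<open>Reflection sends l to n - l < k, into the increasing half of the
        row.\<close>
      have "n choose (n - l) < n choose k"
        using False that \<open>l \<le> n\<close> by (intro binomial_strict_mono) auto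
      then show ?thesis using binomial_symmetric[OF \<open>l \<le> n\<close>] by simp
    qed
  qed
  show ?thesis
    using less[of k l] less[of l k] assms by (cases "k < l") auto
qed

text \<open>For r different from a, the coefficient is up to sign the sum of two binomials
  (different parities) or the difference of two distinct ones (equal parities), nonzero once r
  reaches the smaller of a and b. At r = a only the binomial with b is left, nonzero exactly for b <
  a: hence the strict bound in the other case.\<close>

lemma zeta2_coeff_nonzero_iff:
  assumes "1 \<le> a" "2 \<le> b" "a \<noteq> b" "r \<in> odd_range (a + b)"
  shows "zeta2_coeff a b r \<noteq> 0 \<longleftrightarrow> (if b < a then b \<le> r else a < r)"
proof -
  define x y where "x = (r - 1) choose (a - 1)" and "y = (r - 1) choose (b - 1)"
  note r = odd_rangeD[OF assms(4)]
  have x0: "x = 0 \<longleftrightarrow> r < a" and y0: "y = 0 \<longleftrightarrow> r < b"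
    using assms r by (auto simp: x_def y_def)
  have x1: "x = 1" if "r = a" using that by (simp add: x_def)
  \<comment> \<open>Here r <= N - 2 gives r - 1 < (a - 1) + (b - 1).\<close>
  have xy: "x \<noteq> y" if "a \<le> r \<or> b \<le> r"
    unfolding x_def y_def using that assms r by (intro binomial_distinct) auto
  have c: "zeta2_coeff a b r = (if r = a then 1 else 0) + (-1) ^ a * of_nat x - (-1) ^ b * of_nat y"
    by (simp add: zeta2_coeff_def x_def y_def)
  show ?thesis
  proof (cases "even a")
    case True
    then have "r \<noteq> a" using r by auto
    have "zeta2_coeff a b r \<noteq> 0 \<longleftrightarrow> a \<le> r \<or> b \<le> r"
    proof (cases "even b")
      case b: True
      have "zeta2_coeff a b r = of_nat x - of_nat y" using True b \<open>r \<noteq> a\<close> by (simp add: c)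
      then show ?thesis using xy x0 y0 by (cases "x = y") auto
    next
      case False
      have "zeta2_coeff a b r = of_nat (x + y)" using True False \<open>r \<noteq> a\<close> by (simp add: c)
      then show ?thesis using x0 y0 by (simp only: of_nat_eq_0_iff add_is_0) auto
    qed
    then show ?thesis using \<open>r \<noteq> a\<close> by auto
  next
    case False
    show ?thesis
    proof (cases "r = a")
      case True
      have "zeta2_coeff a b r = - ((-1) ^ b * of_nat y)"
        using True False x1 c by simp
      then show ?thesis using y0 True assms(3) by auto
    next
      case ra: False
      have "zeta2_coeff a b r \<noteq> 0 \<longleftrightarrow> a \<le> r \<or> b \<le> r"
      proof (cases "even b")
        case True
        have "zeta2_coeff a b r = - of_nat (x + y)" using True False ra by (simp add: c)
        then show ?thesis using x0 y0 by (simp only: neg_equal_0_iff_equal of_nat_eq_0_iff add_is_0) auto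
      next
        case b: False
        have "zeta2_coeff a b r = of_nat y - of_nat x" using b False ra by (simp add: c)
        then show ?thesis using xy x0 y0 by (cases "x = y") auto
      qed
      then show ?thesis using ra by auto
    qed
  qed
qed

text \<open>The two binomial terms cancel; only f_a f_a can accompany the power of f_2.\<close>

lemma zeta2_coeff_diagonal: "zeta2_coeff a a r = (if r = a then 1 else 0)"
  by (simp add: zeta2_coeff_def)

lemma I_set_eq:
  assumes "1 \<le> a" "2 \<le> b" "a \<noteq> b"
  shows "I_set a b = insert (a + b) (insert 0 {r \<in> odd_range (a + b). zeta2_coeff a b r \<noteq> 0})"
proof -
  have "{r \<in> odd_range (a + b). zeta2_coeff a b r \<noteq> 0} =
      {r \<in> odd_range (a + b). if b < a then b \<le> r else a < r}"
    using zeta2_coeff_nonzero_iff[OF assms] by blast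
  moreover have "i \<le> a + b - 2 \<longleftrightarrow> i + 2 \<le> a + b" for i
    using assms by linarith
  ultimately show ?thesis
    using assms(3) by (cases "b < a")
      (simp_all add: I_set_def odd_range_def insert_commute conj_ac Suc_le_eq)
qed

lemma J_set_eq:
  assumes "1 \<le> a" "2 \<le> b" "a \<noteq> b"
  shows "J_set a b = insert (a + b) (insert 0
    ((\<lambda>r. a + b - r) ` {r \<in> odd_range (a + b). zeta2_coeff a b r \<noteq> 0}))"
  unfolding J_set_def I_set_eq[OF assms] by auto

text \<open>For even N the largest candidate is r = N - 3; it lies in the required range except for
  the pair (1,3), where it equals 1.\<close>

lemma zeta2_coeff_all_zero:
  assumes "1 \<le> a" "2 \<le> b" "a \<noteq> b" "even (a + b)"
    and "{r \<in> odd_range (a + b). zeta2_coeff a b r \<noteq> 0} = {}"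
  shows "(a, b) = (1, 3)"
proof (rule ccontr)
  assume n: "(a, b) \<noteq> (1, 3)"
  have "a \<noteq> 1 \<or> b \<noteq> 3" using n by simp
  then have "odd (a + b - 3)" "3 \<le> a + b - 3" "a + b - 3 + 2 \<le> a + b"
    "b < a \<Longrightarrow> b \<le> a + b - 3" "\<not> b < a \<Longrightarrow> a < a + b - 3"
    using assms(1-4) by presburger+
  then have "a + b - 3 \<in> odd_range (a + b)" "if b < a then b \<le> a + b - 3 else a < a + b - 3"
    by (simp_all add: odd_range_def)
  then show False using assms(5) zeta2_coeff_nonzero_iff[OF assms(1-3)] by blast
qed

lemma zeta2_range_subset:
  "{r \<in> odd_range N. P r} \<subseteq> {1..<N}" "(\<lambda>r. N - r) ` {r \<in> odd_range N. P r} \<subseteq> {1..<N}"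
  by (auto simp: odd_range_def)

section \<open>Graded pieces and generators\<close>

context normalized
begin

text \<open>Under \<phi>, different degrees are supported on disjoint sets of monomials.\<close>

lemma H_deg_independent:
  assumes "finite A" "\<And>i. i \<in> A \<Longrightarrow> m i \<in> H_deg i" "(\<Sum>i\<in>A. m i) = 0" "k \<in> A"
  shows "m k = 0"
proof -
  have "\<phi> (m k) = 0"
  proof (intro poly_eqI shuf_eqI, rule ccontr)
    fix j ks
    assume nz: "wcoeff (coeff (\<phi> (m k)) j) ks \<noteq> wcoeff (coeff 0 j) ks"
    have U: "wcoeff (coeff (\<phi> (m i)) j) ks \<noteq> 0 \<Longrightarrow> wt ks + 2 * j = i" if "i \<in> A" for i
      using assms(2)[OF that] by (auto simp: H_deg_iff U_deg_def)
    have "0 = wcoeff (coeff (\<phi> (\<Sum>i\<in>A. m i)) j) ks"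
      by (simp add: assms(3) phi_simps)
    also have "\<dots> = (\<Sum>i\<in>A. wcoeff (coeff (\<phi> (m i)) j) ks)"
      by (simp add: phi_sum coeff_sum wcoeff_sum)
    also have "\<dots> = (\<Sum>i\<in>{k}. wcoeff (coeff (\<phi> (m i)) j) ks)"
      using assms(1,4) U[OF assms(4)] U nz by (intro sum.mono_neutral_right) auto
    finally show False using nz by simp
  qed
  then have "\<phi> (m k) = \<phi> 0" by (simp add: phi_simps)
  then show ?thesis using inj_phi by (simp add: inj_eq)
qed

lemma graded_span:
  assumes "finite A" "\<And>i. i \<in> A \<Longrightarrow> e i \<in> H_deg i" "V = spanQ (e ` A)"
  shows "internal_direct_sum V A (\<lambda>i. V \<inter> H_deg i)"
    and "i \<in> A \<Longrightarrow> V \<inter> H_deg i = spanQ {e i}"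
proof -
  have e: "c *\<^sub>Q e i \<in> V \<inter> H_deg i" if "i \<in> A" for c i
    using that assms(2) by (auto simp: assms(3) intro: ratv.span_scale ratv.span_base H_deg_scale)
  show "internal_direct_sum V A (\<lambda>i. V \<inter> H_deg i)"
    unfolding internal_direct_sum_def
  proof (intro conjI ballI ex_ex1I)
    fix v assume "v \<in> V"
    then obtain c where c: "v = (\<Sum>i\<in>A. c i *\<^sub>Q e i)"
      using span_image_coords[OF assms(1)] assms(3) by blast
    let ?m = "\<lambda>i. if i \<in> A then c i *\<^sub>Q e i else 0"
    have "(\<forall>i\<in>A. ?m i \<in> V \<inter> H_deg i) \<and> (\<forall>i. i \<notin> A \<longrightarrow> ?m i = 0) \<and> v = (\<Sum>i\<in>A. ?m i)"
      using e by (auto simp: c intro!: sum.cong)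
    then show "\<exists>m. (\<forall>i\<in>A. m i \<in> V \<inter> H_deg i) \<and> (\<forall>i. i \<notin> A \<longrightarrow> m i = 0) \<and> v = (\<Sum>i\<in>A. m i)"
      by (intro exI[of _ ?m])
  next
    fix v m m'
    assume "(\<forall>i\<in>A. m i \<in> V \<inter> H_deg i) \<and> (\<forall>i. i \<notin> A \<longrightarrow> m i = 0) \<and> v = (\<Sum>i\<in>A. m i)"
      and "(\<forall>i\<in>A. m' i \<in> V \<inter> H_deg i) \<and> (\<forall>i. i \<notin> A \<longrightarrow> m' i = 0) \<and> v = (\<Sum>i\<in>A. m' i)"
    then have m: "\<And>i. i \<in> A \<Longrightarrow> m i \<in> H_deg i" "\<And>i. i \<notin> A \<Longrightarrow> m i = 0" "v = (\<Sum>i\<in>A. m i)"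
      and m': "\<And>i. i \<in> A \<Longrightarrow> m' i \<in> H_deg i" "\<And>i. i \<notin> A \<Longrightarrow> m' i = 0" "v = (\<Sum>i\<in>A. m' i)"
      by auto
    have "m i - m' i = 0" if "i \<in> A" for i
      using H_deg_independent[OF assms(1), of "\<lambda>i. m i - m' i" i] that m m'
      by (simp add: H_deg_diff sum_subtractf)
    then show "m = m'" using m m' by (metis eq_iff_diff_eq_0 ext)
  qed auto
  show "V \<inter> H_deg i = spanQ {e i}" if "i \<in> A"
  proof
    show "V \<inter> H_deg i \<subseteq> spanQ {e i}"
    proof
      fix v assume v: "v \<in> V \<inter> H_deg i"
      then obtain c where c: "v = (\<Sum>i\<in>A. c i *\<^sub>Q e i)"
        using span_image_coords[OF assms(1)] assms(3) by blast
      \<comment> \<open>Subtracting \<open>v\<close> in its own degree makes the sum zero, so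
        independence gives \<open>v = c i *\<^sub>Q e i\<close>.\<close>
      let ?m = "\<lambda>j. c j *\<^sub>Q e j - (if j = i then v else 0)"
      have "(\<Sum>j\<in>A. ?m j) = 0"
        using assms(1) that by (simp add: sum_subtractf flip: c)
      moreover have "?m j \<in> H_deg j" if "j \<in> A" for j
        using e[OF that] v by (auto intro!: H_deg_diff H_deg_zero)
      ultimately have "?m i = 0" using H_deg_independent[OF assms(1), of ?m i] that by blast
      then have "v = c i *\<^sub>Q e i" by simp
      then show "v \<in> spanQ {e i}" by (auto intro: ratv.span_scale ratv.span_base)
    qed
    show "spanQ {e i} \<subseteq> V \<inter> H_deg i"
      using e[OF that] by (auto simp: ratv.span_singleton)
  qed
qed

text \<open>The value u = 0 covers the cases without constants: the index 0 stays, with zero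
  component. The bound on \<open>S\<close> keeps inner degrees apart from 0 and a + b.\<close>

lemma V_mot_graded:
  assumes "1 \<le> a" "1 \<le> b" "S \<subseteq> {1..<a + b}" "u \<in> {0, 1}"
    and V: "V_mot \<phi> a b = spanQ (insert (zeta_m2 a b) (insert u (zeta_m ` S)))"
  shows "internal_direct_sum (V_mot \<phi> a b) (insert (a + b) (insert 0 S)) (V_deg \<phi> a b)"
    and "V_deg \<phi> a b 0 = spanQ {u}"
    and "V_deg \<phi> a b (a + b) = spanQ {zeta_m2 a b}"
    and "i \<in> S \<Longrightarrow> V_deg \<phi> a b i = spanQ {zeta_m i}"
proof -
  define e where "e = (\<lambda>i. if i = a + b then zeta_m2 a b else if i = 0 then u else zeta_m i)"
  let ?A = "insert (a + b) (insert 0 S)"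
  have fin: "finite ?A" using assms(3) finite_subset by auto
  have eS: "e i = zeta_m i" if "i \<in> S" for i
    using that assms(3) by (auto simp: e_def)
  have e0: "e 0 = u" "e (a + b) = zeta_m2 a b" using assms(1) by (auto simp: e_def)
  have e_deg: "e i \<in> H_deg i" if "i \<in> ?A" for i
    using that assms(3,4) eS e0 zeta_m2_H_deg[OF assms(1,2)] zeta_m_H_deg one_H_deg H_deg_zero by auto
  have "e ` ?A = insert (zeta_m2 a b) (insert u (zeta_m ` S))"
    using eS e0 by (auto simp: image_iff)
  then have Ve: "V_mot \<phi> a b = spanQ (e ` ?A)" using V by simp
  have d: "V_deg \<phi> a b = (\<lambda>i. V_mot \<phi> a b \<inter> H_deg i)" by (simp add: V_deg_def fun_eq_iff)
  note g = graded_span[OF fin e_deg Ve, folded d]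
  show "internal_direct_sum (V_mot \<phi> a b) ?A (V_deg \<phi> a b)" by (rule g(1)) auto
  show "V_deg \<phi> a b 0 = spanQ {u}" using g(2)[of 0] by (simp add: V_deg_def e0)
  show "V_deg \<phi> a b (a + b) = spanQ {zeta_m2 a b}" using g(2)[of "a + b"] by (simp add: V_deg_def e0)
  show "i \<in> S \<Longrightarrow> V_deg \<phi> a b i = spanQ {zeta_m i}" using g(2)[of i] by (simp add: V_deg_def eS)
qed

text \<open>At t = 0 the exponential is the neutral element of the group.\<close>

lemma zeta_m2_in_V_mot:
  assumes "1 \<le> a" "2 \<le> b" shows "zeta_m2 a b \<in> V_mot \<phi> a b"
proof -
  have "exp_char 0 0 (word (x # w)) = 0" for x and w :: "nat list"
    by (simp add: exp_char_word)
  then have "act (exp_char 0 0) (zeta_m2 a b) = zeta_m2 a b"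
    using assms by (cases "even (a + b)")
      (simp_all add: act_zeta_m2_even act_zeta_m2_odd rat_alg_hom_exp_char)
  then show ?thesis
    using assms V_mot_eq[of a b] exp_char_U_dR by (auto intro!: ratv.span_base image_eqI[of _ _ "exp_char 0 0"])
qed

lemma act_in_V_mot: "1 \<le> a \<Longrightarrow> 1 \<le> b \<Longrightarrow> g \<in> U_dR \<Longrightarrow> act g (zeta_m2 a b) \<in> V_mot \<phi> a b"
  by (simp add: V_mot_eq ratv.span_base)

text \<open>The exponential of the letter f_r moves zeta(a,b) by c_r zeta(N-r) only. That of f_N,
  which is none of the f_r with r <= N - 2, moves it by the nonzero constant of
  \<open>c_f_zeta_m2_nonzero\<close>.\<close>

lemma V_mot_odd:
  assumes "1 \<le> a" "2 \<le> b" "odd (a + b)"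
  shows "V_mot \<phi> a b = spanQ (insert (zeta_m2 a b) (insert 1
    (zeta_m ` ((\<lambda>r. a + b - r) ` {r \<in> odd_range (a + b). zeta2_coeff a b r \<noteq> 0}))))"
    (is "_ = spanQ ?B")
proof
  let ?N = "a + b" and ?c = "zeta2_coeff a b" and ?z = "zeta_m2 a b"
  let ?C = "c_f ?N (\<phi> ?z)"
  have b: "1 \<le> b" using assms by simp
  have "act g ?z \<in> spanQ ?B" if "g \<in> U_dR" for g
  proof -
    have g: "rat_alg_hom g" using that by (simp add: U_dR_def)
    have "(?c r * g (word [letter r])) *\<^sub>Q zeta_m (?N - r) \<in> spanQ ?B" if "r \<in> odd_range ?N" for r
      by (rule span_coefficient) (use that in blast)
    then show ?thesis
      unfolding act_zeta_m2_odd[OF assms g]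
      by (intro ratv.span_add ratv.span_sum ratv.span_scale[of 1]) (auto intro: ratv.span_base)
  qed
  then show "V_mot \<phi> a b \<subseteq> spanQ ?B"
    unfolding V_mot_eq[OF assms(1) b] by (intro ratv.span_minimal ratv.subspace_span image_subsetI)
  have z: "?z \<in> V_mot \<phi> a b" by (rule zeta_m2_in_V_mot[OF assms(1,2)])
  have diff: "act g ?z - ?z \<in> V_mot \<phi> a b" if "g \<in> U_dR" for g
    using act_in_V_mot[OF assms(1) b that] z by (rule V_mot_subspace(1))
  have N: "3 \<le> ?N" using assms by presburger
  have "act (exp_char (letter ?N) 1) ?z - ?z = ?C *\<^sub>Q 1"
  proof -
    have "letter r \<noteq> letter ?N" if "r \<in> odd_range ?N" for r
      using odd_rangeD[OF that] letter_inj[of r ?N] assms N by auto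
    then have "(\<Sum>r\<in>odd_range ?N. (?c r * exp_char (letter ?N) 1 (word [letter r])) *\<^sub>Q zeta_m (?N - r)) = 0"
      by (intro sum.neutral) (simp add: exp_char_word)
    then show ?thesis
      by (simp add: act_zeta_m2_odd[OF assms rat_alg_hom_exp_char] exp_char_word)
  qed
  then have "?C *\<^sub>Q 1 \<in> V_mot \<phi> a b" using diff[OF exp_char_U_dR] by metis
  then have one: "1 \<in> V_mot \<phi> a b"
    using c_f_zeta_m2_nonzero[OF assms] by (rule V_mot_cancel)
  have "zeta_m (?N - r) \<in> V_mot \<phi> a b" if r: "r \<in> odd_range ?N" "?c r \<noteq> 0" for r
  proof -
    have "exp_char (letter r) 1 (word [letter s]) = (if s = r then 1 else 0)" if "s \<in> odd_range ?N" for s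
      using odd_rangeD[OF that] odd_rangeD[OF r(1)] by (simp add: exp_char_word letter_inj)
    then have "(\<Sum>s\<in>odd_range ?N. (?c s * exp_char (letter r) 1 (word [letter s])) *\<^sub>Q zeta_m (?N - s)) =
        (\<Sum>s\<in>odd_range ?N. if s = r then ?c r *\<^sub>Q zeta_m (?N - r) else 0)"
      by (intro sum.cong) auto
    also have "\<dots> = ?c r *\<^sub>Q zeta_m (?N - r)" using r by (simp add: finite_odd_range)
    moreover have "letter ?N \<noteq> letter r"
      using odd_rangeD[OF r(1)] letter_inj[of r ?N] assms N by auto
    ultimately have "act (exp_char (letter r) 1) ?z - ?z = ?c r *\<^sub>Q zeta_m (?N - r)"
      by (simp add: act_zeta_m2_odd[OF assms rat_alg_hom_exp_char]) (simp add: exp_char_word)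
    then have "?c r *\<^sub>Q zeta_m (?N - r) \<in> V_mot \<phi> a b" using diff[OF exp_char_U_dR] by metis
    then show ?thesis using r(2) by (rule V_mot_cancel)
  qed
  then have "?B \<subseteq> V_mot \<phi> a b" using z one by auto
  then show "spanQ ?B \<subseteq> V_mot \<phi> a b"
    unfolding V_mot_def by (intro ratv.span_minimal) (auto simp: ratv.subspace_span)
qed

text \<open>If \<open>R\<close> is empty, \<phi> gives a multiple of a power of f_2, fixed by the
  group, so no constant arises. Otherwise zeta(r) is isolated by the exponential of f_{N-r}, the
  final letter of f_r f_{N-r}, and 1 by a point evaluated on the whole word.\<close>

lemma V_mot_even:
  assumes "1 \<le> a" "2 \<le> b" "even (a + b)"
  defines "R \<equiv> {r \<in> odd_range (a + b). zeta2_coeff a b r \<noteq> 0}"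
  shows "V_mot \<phi> a b = spanQ (insert (zeta_m2 a b) (insert (if R = {} then 0 else 1) (zeta_m ` R)))"
    (is "_ = spanQ ?B")
proof
  let ?N = "a + b" and ?c = "zeta2_coeff a b" and ?z = "zeta_m2 a b"
  have b: "1 \<le> b" using assms by simp
  have comp: "odd (?N - r)" "3 \<le> ?N - r" if "r \<in> odd_range ?N" for r
    using odd_rangeD[OF that] assms(3) by presburger+
  have "act g ?z \<in> spanQ ?B" if "g \<in> U_dR" for g
  proof -
    have g: "rat_alg_hom g" using that by (simp add: U_dR_def)
    have 1: "(?c r * g (word [letter (?N - r)])) *\<^sub>Q zeta_m r \<in> spanQ ?B" if "r \<in> odd_range ?N" for r
      by (rule span_coefficient) (use that in \<open>auto simp: R_def\<close>)
    have 2: "(\<Sum>r\<in>odd_range ?N. ?c r * g (word [letter r, letter (?N - r)])) *\<^sub>Q 1 \<in> spanQ ?B"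
    proof (cases "R = {}")
      case True
      then have "(\<Sum>r\<in>odd_range ?N. ?c r * g (word [letter r, letter (?N - r)])) = 0"
        by (intro sum.neutral) (auto simp: R_def)
      then show ?thesis by (simp add: ratv.span_zero)
    next
      case False
      then show ?thesis by (intro ratv.span_scale ratv.span_base) simp
    qed
    show ?thesis
      unfolding act_zeta_m2_even[OF assms(1-3) g]
      by (intro ratv.span_add ratv.span_sum 1 2) (auto intro: ratv.span_base)
  qed
  then show "V_mot \<phi> a b \<subseteq> spanQ ?B"
    unfolding V_mot_eq[OF assms(1) b] by (intro ratv.span_minimal ratv.subspace_span image_subsetI)
  have z: "?z \<in> V_mot \<phi> a b" by (rule zeta_m2_in_V_mot[OF assms(1,2)])
  have zeta: "zeta_m r \<in> V_mot \<phi> a b" if r: "r \<in> R" for r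
  proof -
    have rO: "r \<in> odd_range ?N" "?c r \<noteq> 0" using r by (auto simp: R_def)
    let ?l = "letter (?N - r)"
    let ?q = "\<Sum>s\<in>odd_range ?N. ?c s * exp_char ?l 1 (word [letter s, letter (?N - s)])"
    have act: "act (exp_char ?l t) ?z = ?z + (?c r * t) *\<^sub>Q zeta_m r + ?q *\<^sub>Q 1" if "t = 1 \<or> t = -1" for t
    proof -
      have "exp_char ?l t (word [letter (?N - s)]) = (if s = r then t else 0)" if "s \<in> odd_range ?N" for s
        using comp[OF that] comp[OF rO(1)] odd_rangeD[OF that] odd_rangeD[OF rO(1)]
        by (auto simp: exp_char_word letter_inj)
      then have "(\<Sum>s\<in>odd_range ?N. (?c s * exp_char ?l t (word [letter (?N - s)])) *\<^sub>Q zeta_m s) =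
          (\<Sum>s\<in>odd_range ?N. if s = r then (?c r * t) *\<^sub>Q zeta_m r else 0)"
        by (intro sum.cong) auto
      also have "\<dots> = (?c r * t) *\<^sub>Q zeta_m r" using rO by (simp add: finite_odd_range)
      moreover have "exp_char ?l t (word [x, y]) = exp_char ?l 1 (word [x, y])" for x y
        using that by (auto simp: exp_char_word)
      ultimately show ?thesis
        by (simp add: act_zeta_m2_even[OF assms(1-3) rat_alg_hom_exp_char])
    qed
    \<comment> \<open>Taking the odd part in \<open>t\<close> removes the contribution of the square of a letter, present if \<open>2 r = N\<close>.\<close>
    have "act (exp_char ?l 1) ?z - act (exp_char ?l (-1)) ?z = (2 * ?c r) *\<^sub>Q zeta_m r"
      by (simp add: act scaleQ_add_left[symmetric])
    then have "(2 * ?c r) *\<^sub>Q zeta_m r \<in> V_mot \<phi> a b"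
      using V_mot_subspace(1) act_in_V_mot[OF assms(1) b exp_char_U_dR] by metis
    then show ?thesis by (rule V_mot_cancel) (use rO in simp)
  qed
  have one: "1 \<in> V_mot \<phi> a b" if r: "r \<in> R" for r
  proof -
    have rO: "r \<in> odd_range ?N" "?c r \<noteq> 0" using r by (auto simp: R_def)
    let ?l = "letter r" and ?m = "letter (?N - r)"
    \<comment> \<open>The exponential of a primitive element is symmetric on two-letter words and could miss \<open>1\<close>
      when the coefficients of \<open>f\<^sub>r f\<^sub>s\<close> and \<open>f\<^sub>s f\<^sub>r\<close> are opposite; a product of two exponentials is not.\<close>
    define g where "g = exp_char ?l 1 \<circ> right_translate (exp_char ?m 1)"
    have g: "rat_alg_hom g" "g \<in> U_dR"
      unfolding g_def U_dR_def by (simp_all add: rat_alg_hom_convolution rat_alg_hom_exp_char)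
    have g2: "g (word [x, y]) = exp_char ?l 1 (word [x, y]) +
        exp_char ?m 1 (word [y]) * exp_char ?l 1 (word [x]) + exp_char ?m 1 (word [x, y])" for x y
      by (simp add: g_def right_translate_word2 rat_alg_hom_exp_char
          rat_alg_homD[OF rat_alg_hom_exp_char] scaleQ_rat_def)
    \<comment> \<open>The value is 1 for distinct letters and 1/2 + 1 + 1/2 = 2 for equal
      ones.\<close>
    have v: "g (word [?l, ?m]) \<noteq> 0"
      by (auto simp: g2 exp_char_word)
    \<comment> \<open>A nonzero value needs first letter \<open>?l\<close> or second letter
      \<open>?m\<close>, so even the reversed word f_{N-r} f_r is missed if it differs from f_r
      f_{N-r}.\<close>
    have "g (word [letter s, letter (?N - s)]) = 0" if "s \<in> odd_range ?N" "s \<noteq> r" for s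
    proof -
      have n: "letter s \<noteq> ?l" "letter (?N - s) \<noteq> ?m"
        using that comp[OF that(1)] comp[OF rO(1)] odd_rangeD[OF that(1)] odd_rangeD[OF rO(1)]
        by (auto simp: letter_inj)
      then show ?thesis by (simp add: g2 exp_char_word)
    qed
    then have "(\<Sum>s\<in>odd_range ?N. ?c s * g (word [letter s, letter (?N - s)])) =
        (\<Sum>s\<in>odd_range ?N. if s = r then ?c r * g (word [?l, ?m]) else 0)"
      by (intro sum.cong) auto
    also have "\<dots> = ?c r * g (word [?l, ?m])" using rO by (simp add: finite_odd_range)
    finally have eq: "act g ?z - ?z - (\<Sum>s\<in>odd_range ?N. (?c s * g (word [letter (?N - s)])) *\<^sub>Q zeta_m s) =
        (?c r * g (word [?l, ?m])) *\<^sub>Q 1"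
      by (simp add: act_zeta_m2_even[OF assms(1-3) g(1)])
    have terms: "(?c s * g (word [letter (?N - s)])) *\<^sub>Q zeta_m s \<in> V_mot \<phi> a b" if "s \<in> odd_range ?N" for s
    proof (cases "?c s = 0")
      case True
      then show ?thesis using V_mot_subspace(2)[OF z, of 0] by simp
    next
      case False
      then show ?thesis using that zeta by (intro V_mot_subspace(2)) (simp add: R_def)
    qed
    have "(?c r * g (word [?l, ?m])) *\<^sub>Q 1 \<in> V_mot \<phi> a b"
      unfolding eq[symmetric] by (intro V_mot_subspace(1,3) act_in_V_mot[OF assms(1) b g(2)] z terms)
    then show ?thesis by (rule V_mot_cancel) (use rO v in simp)
  qed
  have "0 \<in> V_mot \<phi> a b" using V_mot_subspace(2)[OF z, of 0] by simp
  then have "?B \<subseteq> V_mot \<phi> a b" using z one zeta by auto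
  then show "spanQ ?B \<subseteq> V_mot \<phi> a b"
    unfolding V_mot_def by (intro ratv.span_minimal) (auto simp: ratv.subspace_span)
qed

end

text \<open>The pair (1,3) is a genuine exception in degree 0: there is no odd r between 3 and N - 2
  = 2, so zeta(1,3) is a rational multiple of f_2^2 and the degree 0 part is zero. The direct sum
  over \<open>I_set\<close> persists with this zero component.\<close>

theorem corollary8p11:
  fixes \<phi> :: "mmzv \<Rightarrow> f_alphabet" and a b :: nat
  assumes "normalized_iso \<phi>"
    and "a \<ge> 1" and "b \<ge> 2" and "a \<noteq> b"
  shows
    "(a \<ge> 2 \<and> even a \<longrightarrow>
        V_mot \<phi> a a = V_deg \<phi> a a (2 * a) \<and> V_deg \<phi> a a (2 * a) = spanQ {zeta_m2 a a}) \<and>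
     (a \<ge> 3 \<and> odd a \<longrightarrow>
        internal_direct_sum (V_mot \<phi> a a) {0, a, 2 * a} (V_deg \<phi> a a) \<and>
        V_deg \<phi> a a 0 = spanQ {1} \<and>
        V_deg \<phi> a a a = spanQ {zeta_m a} \<and>
        V_deg \<phi> a a (2 * a) = spanQ {zeta_m2 a a}) \<and>
     ((even a \<longleftrightarrow> even b) \<longrightarrow>
        internal_direct_sum (V_mot \<phi> a b) (I_set a b) (V_deg \<phi> a b) \<and>
        ((a, b) \<noteq> (1, 3) \<longrightarrow> V_deg \<phi> a b 0 = spanQ {1}) \<and>
        V_deg \<phi> a b (a + b) = spanQ {zeta_m2 a b} \<and>
        (\<forall>i \<in> I_set a b - {0, a + b}. V_deg \<phi> a b i = spanQ {zeta_m i})) \<and>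
     (\<not> (even a \<longleftrightarrow> even b) \<longrightarrow>
        internal_direct_sum (V_mot \<phi> a b) (J_set a b) (V_deg \<phi> a b) \<and>
        V_deg \<phi> a b 0 = spanQ {1} \<and>
        V_deg \<phi> a b (a + b) = spanQ {zeta_m2 a b} \<and>
        (\<forall>j \<in> J_set a b - {0, a + b}. V_deg \<phi> a b j = spanQ {zeta_m j}))"
proof -
  interpret normalized \<phi> by unfold_locales (rule assms(1))
  let ?R = "\<lambda>a b. {r \<in> odd_range (a + b). zeta2_coeff a b r \<noteq> 0}"
  have b: "1 \<le> b" using assms by simp
  have p1: "V_mot \<phi> a a = V_deg \<phi> a a (2 * a) \<and> V_deg \<phi> a a (2 * a) = spanQ {zeta_m2 a a}"
    if "a \<ge> 2 \<and> even a"
  proof -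
    have R: "?R a a = {}" using that by (auto simp: zeta2_coeff_diagonal odd_range_def)
    then have V: "V_mot \<phi> a a = spanQ (insert (zeta_m2 a a) (insert 0 (zeta_m ` {})))"
      using V_mot_even[of a a] that unfolding R by simp
    have "V_deg \<phi> a a (a + a) = spanQ {zeta_m2 a a}"
      using that by (intro V_mot_graded(3)[OF _ _ _ _ V]) auto
    moreover have "V_mot \<phi> a a = spanQ {zeta_m2 a a}"
      unfolding V by (simp add: insert_commute[of _ 0])
    ultimately show ?thesis by (simp add: mult_2)
  qed
  have p2: "internal_direct_sum (V_mot \<phi> a a) {0, a, 2 * a} (V_deg \<phi> a a) \<and>
      V_deg \<phi> a a 0 = spanQ {1} \<and> V_deg \<phi> a a a = spanQ {zeta_m a} \<and>
      V_deg \<phi> a a (2 * a) = spanQ {zeta_m2 a a}" if "a \<ge> 3 \<and> odd a"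
  proof -
    have R: "?R a a = {a}" using that by (auto simp: zeta2_coeff_diagonal odd_range_def)
    then have V: "V_mot \<phi> a a = spanQ (insert (zeta_m2 a a) (insert 1 (zeta_m ` {a})))"
      using V_mot_even[of a a] that unfolding R by simp
    have "insert (a + a) (insert 0 {a}) = {0, a, 2 * a}" by auto
    then show ?thesis
      using V_mot_graded[OF _ _ _ _ V] that by (simp add: mult_2)
  qed
  have p3: "internal_direct_sum (V_mot \<phi> a b) (I_set a b) (V_deg \<phi> a b) \<and>
      ((a, b) \<noteq> (1, 3) \<longrightarrow> V_deg \<phi> a b 0 = spanQ {1}) \<and>
      V_deg \<phi> a b (a + b) = spanQ {zeta_m2 a b} \<and>
      (\<forall>i \<in> I_set a b - {0, a + b}. V_deg \<phi> a b i = spanQ {zeta_m i})" if "even a \<longleftrightarrow> even b"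
  proof -
    have ev: "even (a + b)" using that by simp
    have "(if ?R a b = {} then 0 else 1) \<in> {0, 1 :: mmzv}" by simp
    note g = V_mot_graded[OF assms(2) b zeta2_range_subset(1) this V_mot_even[OF assms(2,3) ev]]
    have "V_deg \<phi> a b 0 = spanQ {1}" if "(a, b) \<noteq> (1, 3)"
    proof -
      have "?R a b \<noteq> {}" using zeta2_coeff_all_zero[OF assms(2-4) ev] that by blast
      from g(2)[unfolded if_not_P[OF this]] show ?thesis .
    qed
    then show ?thesis
      unfolding I_set_eq[OF assms(2-4)] using g(1,3,4) by blast
  qed
  have p4: "internal_direct_sum (V_mot \<phi> a b) (J_set a b) (V_deg \<phi> a b) \<and>
      V_deg \<phi> a b 0 = spanQ {1} \<and>
      V_deg \<phi> a b (a + b) = spanQ {zeta_m2 a b} \<and>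
      (\<forall>j \<in> J_set a b - {0, a + b}. V_deg \<phi> a b j = spanQ {zeta_m j})" if "\<not> (even a \<longleftrightarrow> even b)"
  proof -
    have od: "odd (a + b)" using that by simp
    note g = V_mot_graded[OF assms(2) b zeta2_range_subset(2) _ V_mot_odd[OF assms(2,3) od]]
    show ?thesis
      unfolding J_set_eq[OF assms(2-4)] using g by blast
  qed
  show ?thesis
    by (rule conjI[OF impI[OF p1] conjI[OF impI[OF p2] conjI[OF impI[OF p3] impI[OF p4]]]])
qed

end
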